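(* Let $n\ge2$ be an integer and let $k$ be a positive integer. Then the vertex operator superalgebra $L_{sl(1|n)}(k,0)$ is not $C_2$-cofinite.
   Context: All spaces are over $\mathbb{C}$. $\mathfrak{g}=sl(1|n)$ consists of the block matrices $\begin{pmatrix}A&B\\C&D\end{pmatrix}$ ($A$ of size $1\times1$, $D$ of size $n\times n$) with $\mathrm{Str}=\mathrm{tr}A-\mathrm{tr}D=0$, equipped with the nondegenerate even supersymmetric invariant form $(X|Y)=-\mathrm{Str}(XY)$. Put $\hat{\mathfrak{g}}=\mathfrak{g}\otimes\mathbb{C}[t,t^{-1}]\oplus\mathbb{C}K$, $x(m)=x\otimes t^m$, $[x(m),y(l)]=[x,y](m+l)+(x|y)m\delta_{m+l,0}K$, $K$ central. $V^k(\mathfrak{g})=\mathrm{Ind}_{\mathfrak{g}\otimes\mathbb{C}[t]\oplus\mathbb{C}K}^{\hat{\mathfrak{g}}}\mathbb{C}\mathbf{1}$, where $\mathfrak{g}\otimes\mathbb{C}[t]$ acts on $\mathbf{1}$ by $0$ and $K$ by $k$; $L_{\mathfrak{g}}(k,0)$ is its unique irreducible quotient. It is a vertex operator superalgebra with vacuum $\mathbf{1}$, $Y(x(-1)\mathbf{1},z)=\sum_{m\in\mathbb{Z}}x(m)z^{-m-1}$ for $x\in\mathfrak{g}$, and conformal vector $\omega=\frac{1}{2(k+h^\vee)}\sum_ia^i(-1)b^i(-1)\mathbf{1}$, where $\{a^i\},\{b^i\}$ are dual bases of $\mathfrak{g}$ and $h^\vee$ is the dual Coxeter number of $(\mathfrak{g},(\cdot|\cdot))$.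 A vertex operator superalgebra $V$, with $Y(v,z)=\sum_{m\in\mathbb{Z}}v_mz^{-m-1}$, is $C_2$-cofinite if $\dim V/C_2(V)<\infty$, where $C_2(V)$ is the linear span of $\{u_{-2}v\mid u,v\in V\}$. *)

theory Defs
  imports "HOL-Analysis.Analysis" "HOL-Library.Poly_Mapping"
begin

section \<open>The Lie superalgebra $sl(1|n)$\<close>

text \<open>
  Here $n$ is the cardinality of the index type. The row and column index \<open>None\<close> is the
  $1 \times 1$ block, the indices \<open>Some i\<close> form the $n \times n$ block.
\<close>

type_synonym 'n bmat = "complex ^ 'n option ^ 'n option"

definition supertrace :: "('n::finite) bmat \<Rightarrow> complex" where
  "supertrace X = X $ None $ None - (\<Sum>i\<in>UNIV. X $ Some i $ Some i)"

definition even_part :: "('n::finite) bmat \<Rightarrow> 'n bmat" where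
  "even_part X = (\<chi> i j. if (i = None) = (j = None) then X $ i $ j else 0)"

definition odd_part :: "('n::finite) bmat \<Rightarrow> 'n bmat" where
  "odd_part X = (\<chi> i j. if (i = None) = (j = None) then 0 else X $ i $ j)"

text \<open>The bilinear extension of $[X,Y] = XY - (-1)^{|X||Y|} YX$.\<close>

definition supercommutator :: "('n::finite) bmat \<Rightarrow> 'n bmat \<Rightarrow> 'n bmat" where
  "supercommutator X Y = X ** Y
     - (even_part Y ** even_part X + even_part Y ** odd_part X
        + odd_part Y ** even_part X - odd_part Y ** odd_part X)"

lemma supertrace_alt:
  "supertrace X = (\<Sum>i\<in>UNIV. (if i = None then 1 else -1) * X $ i $ i)"
proof -
  have "sum f (UNIV :: 'a option set) = f None + (\<Sum>i\<in>UNIV. f (Some i))" for f :: "'a option \<Rightarrow> complex"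
    by (simp add: UNIV_option_conv sum.reindex)
  then show ?thesis
    by (simp add: supertrace_def sum_negf)
qed

lemma supertrace_supercommutator: "supertrace (supercommutator X Y) = 0"
proof -
  let ?s = "\<lambda>i::'a option. (if i = None then 1 else -1) :: complex"
  have diag: "?s i * supercommutator X Y $ i $ i
      = (\<Sum>j\<in>UNIV. ?s i * (X $ i $ j * Y $ j $ i)) - (\<Sum>j\<in>UNIV. ?s j * (X $ j $ i * Y $ i $ j))" for i
  proof -
    have "supercommutator X Y $ i $ i = (\<Sum>j\<in>UNIV. X $ i $ j * Y $ j $ i)
        - (\<Sum>j\<in>UNIV. (if (i = None) = (j = None) then 1 else -1) * (X $ j $ i * Y $ i $ j))"
      by (simp add: supercommutator_def matrix_matrix_mult_def even_part_def odd_part_def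
          flip: sum.distrib sum_subtractf)
        (auto intro!: sum.cong simp: mult.commute)
    then show ?thesis
      by (simp add: right_diff_distrib sum_distrib_left) (auto intro!: sum.cong)
  qed
  show ?thesis
    unfolding supertrace_alt diag sum_subtractf
    by (subst (2) sum.swap) simp
qed

typedef ('n::finite) sl1 = "{X :: 'n bmat. supertrace X = 0}"
  by (rule exI[of _ 0]) (simp add: supertrace_def)

setup_lifting type_definition_sl1

instantiation sl1 :: (finite) ab_group_add
begin

lift_definition zero_sl1 :: "'a sl1" is 0
  by (simp add: supertrace_def)
lift_definition plus_sl1 :: "'a sl1 \<Rightarrow> 'a sl1 \<Rightarrow> 'a sl1" is "(+)"
  by (simp add: supertrace_alt algebra_simps sum.distrib)
lift_definition minus_sl1 :: "'a sl1 \<Rightarrow> 'a sl1 \<Rightarrow> 'a sl1" is "(-)"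
  by (simp add: supertrace_alt algebra_simps sum_subtractf)
lift_definition uminus_sl1 :: "'a sl1 \<Rightarrow> 'a sl1" is uminus
  by (simp add: supertrace_alt sum_negf)

instance by standard (transfer, simp)+

end

lift_definition sl_scale :: "complex \<Rightarrow> 'n::finite sl1 \<Rightarrow> 'n sl1"
  is "\<lambda>c X. \<chi> i j. c * X $ i $ j"
proof -
  fix c and X :: "'n bmat"
  assume "supertrace X = 0"
  moreover have "supertrace (\<chi> i j. c * X $ i $ j) = c * supertrace X"
    by (simp add: supertrace_def right_diff_distrib sum_distrib_left)
  ultimately show "supertrace (\<chi> i j. c * X $ i $ j) = 0" by simp
qed

global_interpretation sl: vector_space "sl_scale :: complex \<Rightarrow> 'n::finite sl1 \<Rightarrow> 'n sl1"
  by standard (transfer, simp add: vec_eq_iff algebra_simps)+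

lift_definition sl_bracket :: "'n::finite sl1 \<Rightarrow> 'n sl1 \<Rightarrow> 'n sl1" is supercommutator
  by (rule supertrace_supercommutator)

lift_definition sl_even :: "'n::finite sl1 \<Rightarrow> bool" is "\<lambda>X. odd_part X = 0" .

lift_definition sl_odd :: "'n::finite sl1 \<Rightarrow> bool" is "\<lambda>X. even_part X = 0" .

lift_definition sl_form :: "'n::finite sl1 \<Rightarrow> 'n sl1 \<Rightarrow> complex" is "\<lambda>X Y. - supertrace (X ** Y)" .

text \<open>
  The form is supersymmetric, so the order of the arguments matters on the odd part. The convention
  $(b^i|a^j) = \delta_{ij}$ is the one for which $\sum_i a^i \otimes b^i$ is
  $\mathfrak g$-invariant.
\<close>

definition dual_bases :: "nat \<Rightarrow> (nat \<Rightarrow> 'n::finite sl1) \<Rightarrow> (nat \<Rightarrow> 'n sl1) \<Rightarrow> bool" where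
  "dual_bases d a b \<longleftrightarrow>
     inj_on a {..<d} \<and> sl.independent (a ` {..<d}) \<and> sl.span (a ` {..<d}) = UNIV \<and>
     inj_on b {..<d} \<and> sl.independent (b ` {..<d}) \<and> sl.span (b ` {..<d}) = UNIV \<and>
     (\<forall>i<d. \<forall>j<d. sl_form (b i) (a j) = (if i = j then 1 else 0))"

text \<open>
  The dual Coxeter number of $(\mathfrak g, (\cdot|\cdot))$ is half the eigenvalue of the Casimir
  element on the adjoint representation.
\<close>

definition is_dual_coxeter_number :: "'n::finite itself \<Rightarrow> complex \<Rightarrow> bool" where
  "is_dual_coxeter_number _ h \<longleftrightarrow>
     (\<forall>d (a :: nat \<Rightarrow> 'n sl1) b. dual_bases d a b \<longrightarrow>
       (\<forall>x. (\<Sum>i<d. sl_bracket (a i) (sl_bracket (b i) x)) = sl_scale (2 * h) x))"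


section \<open>The affine Lie superalgebra\<close>

text \<open>
  A pair \<open>(f, c)\<close> stands for $\sum_m f_m \otimes t^m + c K$.
\<close>

type_synonym 'n affine = "(int \<Rightarrow>\<^sub>0 'n sl1) \<times> complex"

definition mode :: "'n::finite sl1 \<Rightarrow> int \<Rightarrow> 'n affine" where
  "mode x m = (Poly_Mapping.single m x, 0)"

definition aff_scale :: "complex \<Rightarrow> 'n::finite affine \<Rightarrow> 'n affine" where
  "aff_scale c x = (Poly_Mapping.map (sl_scale c) (fst x), c * snd x)"

definition aff_bracket :: "'n::finite affine \<Rightarrow> 'n affine \<Rightarrow> 'n affine" where
  "aff_bracket x y =
     (\<Sum>m\<in>Poly_Mapping.keys (fst x). \<Sum>l\<in>Poly_Mapping.keys (fst y).
        Poly_Mapping.single (m + l) (sl_bracket (Poly_Mapping.lookup (fst x) m) (Poly_Mapping.lookup (fst y) l)),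
      \<Sum>m\<in>Poly_Mapping.keys (fst x). \<Sum>l\<in>Poly_Mapping.keys (fst y).
        if m + l = 0 then of_int m * sl_form (Poly_Mapping.lookup (fst x) m) (Poly_Mapping.lookup (fst y) l) else 0)"

definition aff_homogeneous :: "bool \<Rightarrow> 'n::finite affine \<Rightarrow> bool" where
  "aff_homogeneous p x \<longleftrightarrow>
     (if p then (\<forall>m. sl_odd (Poly_Mapping.lookup (fst x) m)) \<and> snd x = 0
      else (\<forall>m. sl_even (Poly_Mapping.lookup (fst x) m)))"

definition super_sign :: "bool \<Rightarrow> bool \<Rightarrow> complex" where
  "super_sign p q = (if p \<and> q then -1 else 1)"

definition aff_nonneg :: "'n::finite affine set" where
  "aff_nonneg = {x. \<forall>m<0. Poly_Mapping.lookup (fst x) m = 0}"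


section \<open>The induced module\<close>

text \<open>
  Words under concatenation form a monoid, so \<open>'a word \<Rightarrow>\<^sub>0 complex\<close> is the free
  unital associative algebra on the set of letters.
\<close>

datatype 'a word = Word "'a list"

instantiation word :: (type) monoid_add
begin

definition zero_word :: "'a word" where "0 = Word []"

fun plus_word :: "'a word \<Rightarrow> 'a word \<Rightarrow> 'a word" where
  "Word u + Word v = Word (u @ v)"

instance
proof
  fix a b c :: "'a word"
  show "a + b + c = a + (b + c)" by (cases a; cases b; cases c) simp
  show "0 + a = a" "a + 0 = a" by (cases a; simp add: zero_word_def)+
qed

end

type_synonym 'n free_alg = "'n affine word \<Rightarrow>\<^sub>0 complex"

definition fa_scale :: "complex \<Rightarrow> 'n::finite free_alg \<Rightarrow> 'n free_alg" where
  "fa_scale c u = Poly_Mapping.single 0 c * u"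

definition gen :: "'n::finite affine \<Rightarrow> 'n free_alg" where
  "gen x = Poly_Mapping.single (Word [x]) 1"

global_interpretation fa: vector_space "fa_scale :: complex \<Rightarrow> 'n::finite free_alg \<Rightarrow> 'n free_alg"
proof
  fix a b :: complex and x y :: "'n free_alg"
  show "fa_scale a (x + y) = fa_scale a x + fa_scale a y"
    by (simp add: fa_scale_def distrib_left)
  show "fa_scale (a + b) x = fa_scale a x + fa_scale b x"
    by (simp add: fa_scale_def single_add distrib_right)
  show "fa_scale a (fa_scale b x) = fa_scale (a * b) x"
    by (simp add: fa_scale_def mult_single flip: mult.assoc)
  show "fa_scale 1 x = x"
    by (simp add: fa_scale_def)
qed

text \<open>
  The quotient of the free algebra by the following two-sided ideal is the universal enveloping
  algebra $U(\hat{\mathfrak g})$; the first family of relations makes the free algebra into the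
  tensor algebra of the vector space $\hat{\mathfrak g}$.
\<close>

definition enveloping_relations :: "'n::finite free_alg set" where
  "enveloping_relations =
     {gen (aff_scale c x + y) - (fa_scale c (gen x) + gen y) | c x y. True} \<union>
     {gen x * gen y - fa_scale (super_sign p q) (gen y * gen x) - gen (aff_bracket x y)
        | p q x y. aff_homogeneous p x \<and> aff_homogeneous q y}"

definition enveloping_ideal :: "'n::finite free_alg set" where
  "enveloping_ideal = fa.span {u * r * v | u r v. r \<in> enveloping_relations}"

text \<open>
  With $\mathfrak p = \mathfrak g \otimes \mathbb C[t] \oplus \mathbb C K$ and the character
  $\chi$ of $\mathfrak p$ that vanishes on $\mathfrak g \otimes \mathbb C[t]$ and has
  $\chi(K) = k$, the induced module $U(\hat{\mathfrak g}) \otimes_{U(\mathfrak p)} \mathbb C_\chi$ is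
  $U(\hat{\mathfrak g}) / \sum_{y \in \mathfrak p} U(\hat{\mathfrak g})(y - \chi(y))$.
  Its elements are the classes \<open>vk_class k u\<close>, with \<open>vk_class k 1\<close> the vacuum and
  \<open>x\<close> acting by left multiplication with \<open>gen x\<close>.
\<close>

definition vk_ideal :: "complex \<Rightarrow> 'n::finite free_alg set" where
  "vk_ideal k = fa.span (enveloping_ideal \<union>
     {u * (gen y - fa_scale (k * snd y) 1) | u y. y \<in> aff_nonneg})"

definition vk_rel :: "complex \<Rightarrow> ('n::finite free_alg \<times> 'n free_alg) set" where
  "vk_rel k = {(u, v). u - v \<in> vk_ideal k}"

definition vk_module :: "complex \<Rightarrow> 'n::finite free_alg set set" where
  "vk_module k = UNIV // vk_rel k"

definition vk_class :: "complex \<Rightarrow> 'n::finite free_alg \<Rightarrow> 'n free_alg set" where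
  "vk_class k u = vk_rel k `` {u}"

text \<open>
  The type \<open>'v\<close> with the action \<open>act\<close> is an irreducible quotient of $V^k(\mathfrak g)$ with
  quotient map \<open>proj\<close>.
\<close>

locale irreducible_vk_quotient = vector_space scale
  for scale :: "complex \<Rightarrow> 'v::ab_group_add \<Rightarrow> 'v" +
  fixes k :: complex
    and act :: "'n::finite affine \<Rightarrow> 'v \<Rightarrow> 'v"
    and proj :: "'n free_alg set \<Rightarrow> 'v"
  assumes proj_surj: "proj ` vk_module k = UNIV"
    and proj_add: "proj (vk_class k (u + v)) = proj (vk_class k u) + proj (vk_class k v)"
    and proj_scale: "proj (vk_class k (fa_scale c u)) = scale c (proj (vk_class k u))"
    and proj_act: "proj (vk_class k (gen x * u)) = act x (proj (vk_class k u))"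
    and nontrivial: "\<exists>v :: 'v. v \<noteq> 0"
    and irreducible:
      "subspace W \<Longrightarrow> (\<And>x w. w \<in> W \<Longrightarrow> act x w \<in> W) \<Longrightarrow> W = {0} \<or> W = UNIV"


section \<open>Vertex operator superalgebras\<close>

text \<open>
  \<open>V p\<close> is the even (\<open>p = False\<close>) or odd (\<open>p = True\<close>) subspace, and \<open>Y u m v\<close> is $u_m v$.
  The Jacobi identity is stated in its component form (the Borcherds identity). Its sums have
  finite support by truncation; \<open>Sum_any\<close> is the sum over the support.
\<close>

locale vertex_superalgebra = vector_space scale
  for scale :: "complex \<Rightarrow> 'v::ab_group_add \<Rightarrow> 'v" +
  fixes V :: "bool \<Rightarrow> 'v set"
    and Y :: "'v \<Rightarrow> int \<Rightarrow> 'v \<Rightarrow> 'v"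
    and vac :: 'v
  assumes parity_subspace: "subspace (V p)"
    and parity_disjoint: "V False \<inter> V True = {0}"
    and parity_sum: "\<exists>u0\<in>V False. \<exists>u1\<in>V True. u = u0 + u1"
    and Y_add_left: "Y (u + v) m w = Y u m w + Y v m w"
    and Y_scale_left: "Y (scale c u) m w = scale c (Y u m w)"
    and Y_add_right: "Y u m (v + w) = Y u m v + Y u m w"
    and Y_scale_right: "Y u m (scale c w) = scale c (Y u m w)"
    and truncation: "\<exists>N. \<forall>m\<ge>N. Y u m v = 0"
    and Y_parity: "u \<in> V p \<Longrightarrow> v \<in> V q \<Longrightarrow> Y u m v \<in> V (p \<noteq> q)"
    and vac_even: "vac \<in> V False"
    and vacuum: "Y vac m v = (if m = -1 then v else 0)"
    and creation: "Y u (-1) vac = u"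
    and creation_nonneg: "m \<ge> 0 \<Longrightarrow> Y u m vac = 0"
    and jacobi: "u \<in> V p \<Longrightarrow> v \<in> V q \<Longrightarrow>
      Sum_any (\<lambda>i::nat. scale (of_int m gchoose i) (Y (Y u (l + int i) v) (m + r - int i) w)) =
      Sum_any (\<lambda>i::nat. scale ((-1) ^ i * (of_int l gchoose i))
        (Y u (m + l - int i) (Y v (r + int i) w)
         - scale ((-1) powi l * super_sign p q) (Y v (r + l - int i) (Y u (m + int i) w))))"
begin

definition C2 :: "'v set" where
  "C2 = span {Y u (-2) v | u v. True}"

text \<open>Finitely many cosets \<open>b + C2\<close> with \<open>b \<in> B\<close> span the quotient space.\<close>

definition C2_cofinite :: bool where
  "C2_cofinite \<longleftrightarrow> (\<exists>B. finite B \<and> (\<forall>v. \<exists>b\<in>span B. v - b \<in> C2))"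

end

text \<open>
  The grading by eigenvalues of $L(0) = \omega_1$ may take values in $\frac12\mathbb Z$, and no
  relation between it and the parity is imposed.
\<close>

locale vertex_operator_superalgebra = vertex_superalgebra scale V Y vac
  for scale :: "complex \<Rightarrow> 'v::ab_group_add \<Rightarrow> 'v" and V Y vac +
  fixes \<omega> :: 'v
  assumes omega_even: "\<omega> \<in> V False"
    and virasoro: "\<exists>c. \<forall>m l v.
      Y \<omega> (m + 1) (Y \<omega> (l + 1) v) - Y \<omega> (l + 1) (Y \<omega> (m + 1) v) =
      scale (of_int (m - l)) (Y \<omega> (m + l + 1) v)
      + scale (if m + l = 0 then of_int (m ^ 3 - m) / 12 * c else 0) v"
    and translation: "Y (Y \<omega> 0 u) m v = scale (- of_int m) (Y u (m - 1) v)"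
    and grading: "span (\<Union>j::int. {v. Y \<omega> 1 v = scale (of_int j / 2) v}) = UNIV"
    and grading_finite:
      "\<exists>B. finite B \<and> {v. Y \<omega> 1 v = scale (of_int (j :: int) / 2) v} \<subseteq> span B"
    and grading_bounded: "\<exists>N. \<forall>j::int. j < N \<longrightarrow> {v. Y \<omega> 1 v = scale (of_int j / 2) v} = {0}"

end

theory Submission
  imports Defs
begin

text \<open>
  Let $J = \mathrm{diag}(\frac n{n-1}; \frac1{n-1}, \dots, \frac1{n-1})$ (\<open>central_elt\<close>). It acts on
  $\mathfrak g$ with eigenvalues $-1, 0, 1$, the charges, and $(J|J) = -\frac n{n-1}$ is negative.
  This sign is the reason for the theorem.

  Suppose that the vertex operator superalgebra $V$ is $C_2$-cofinite. Since $C_2(V)$ is spanned by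
  vectors $x(-2-q)u$ (\<open>C2_subset_deep_span\<close>), an induction on the conformal weight
  shows that the vectors $x(-2-q)u + x(-1-q)u$ also span a subspace of finite codimension
  (\<open>cofinite_mod_zhu_relations\<close>); this is the step from $C_2(V)$ to the Zhu algebra. So
  a nontrivial combination $\sum_i c_i J(-1)^i \mathbf 1$ lies in that subspace
  (\<open>cofinite_relation\<close>). The zero mode of such a vector vanishes on lowest weight vectors of
  every $V$-module, and that of $J(-1)^i \mathbf 1$ is $J(0)^i$ there, so $J(0)$ has only
  finitely many eigenvalues on lowest weight vectors, uniformly over all modules.

  The spectral flows of $V$ violate this. For a positive integer $s$ let $x(j)$, for $x$ of charge $c$,
  act on $V$ as $x(j + sc)$ used to, up to a scalar for $j = 0$: $J(0)$ becomes $J(0) + sk(J|J)$.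
  This is a module for the vertex algebra $V$ and not only for $\hat{\mathfrak g}$, since its fields are
  $Y(z^{sJ(0)} \Delta(z)u, z)$ with Li's operator
  $\Delta(z) = \exp(\sum_{j \ge 1} (-1)^{j+1} \frac sj J(j) z^{-j})$. That operator is built
  from modes of $V$ itself, hence it is well defined on the
  quotient $V$ of $V^k(\mathfrak g)$. Its coefficients are
  \<open>Delta s i\<close>, the modes of the new fields are \<open>twisted_mode\<close>, and instead of
  constructing the module it is enough to compute these modes on one vector.

  The spectral flow has a lowest weight vector $w$ (\<open>top_vector_exists\<close>) of charge $r$ and
  weight $N$ with $N + sr \le 0$, where $N + sr$ is, up to a shift, the weight in the spectral flow:
  starting from $\mathbf 1$, which has $N = r = 0$, one applies operators that lower it. Modes of
  charge $-1$ anticommute, and among those that lower $N + sr$ only finitely many, up to linear combination, do not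
  annihilate $\mathbf 1$; the other operators lower $N$ as well. So this stops. On $w$ the zero modes behave as expected
  (\<open>zero_mode_zhu_relations\<close>, \<open>zero_mode_heisenberg\<close>), so
  $\lambda_s = r - sk\frac n{n-1}$ is a root of $\sum_i c_i \lambda^i$. As
  $N$ is bounded below, $r$ is bounded above independently of $s$, hence $\lambda_s \to -\infty$, and the
  nonzero polynomial $\sum_i c_i \lambda^i$ has infinitely many roots, a contradiction.
\<close>

section \<open>Charges and the invariant form on $sl(1|n)$\<close>

lemma supercommutator_nth:
  "supercommutator X Y $ i $ j = (\<Sum>l\<in>UNIV. X $ i $ l * Y $ l $ j
     - (if (i = None) \<noteq> (l = None) \<and> (l = None) \<noteq> (j = None) then -1 else 1) * (Y $ i $ l * X $ l $ j))"
  by (simp add: supercommutator_def matrix_matrix_mult_def even_part_def odd_part_def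
      flip: sum.distrib sum_subtractf) (auto intro!: sum.cong)

lemma supertrace_mult:
  "supertrace (X ** Y) = (\<Sum>i\<in>UNIV. \<Sum>l\<in>UNIV. (if i = None then 1 else -1) * (X $ i $ l * Y $ l $ i))"
  by (simp add: supertrace_alt matrix_matrix_mult_def sum_distrib_left)

lemma sl_bracket_add_left: "sl_bracket (x + y) z = sl_bracket x z + sl_bracket y z"
  by transfer (simp add: vec_eq_iff supercommutator_nth algebra_simps flip: sum.distrib)

lemma sl_bracket_add_right: "sl_bracket x (y + z) = sl_bracket x y + sl_bracket x z"
  by transfer (simp add: vec_eq_iff supercommutator_nth algebra_simps flip: sum.distrib)

lemma sl_form_add_left: "sl_form (x + y) z = sl_form x z + sl_form y z"
  by transfer (simp add: supertrace_mult algebra_simps sum.distrib)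

lemma sl_form_add_right: "sl_form x (y + z) = sl_form x y + sl_form x z"
  by transfer (simp add: supertrace_mult algebra_simps sum.distrib)

lemma sl_form_scale_left: "sl_form (sl_scale c x) z = c * sl_form x z"
  by transfer (simp add: supertrace_mult sum_distrib_left algebra_simps)

lemma sl_form_scale_right: "sl_form x (sl_scale c z) = c * sl_form x z"
  by transfer (simp add: supertrace_mult sum_distrib_left algebra_simps)

text \<open>After cyclic renaming of the indices both sides contain the same monomials in the matrix entries, and
  the signs agree since
  $(-1)^{i + (i+l)(l+j)} = (-1)^{l + (j+i)(i+l)}$ for bits $i, j, l$.\<close>

lemma sl_form_invariant: "sl_form (sl_bracket x y) z = sl_form x (sl_bracket y z)"
proof (transfer, simp)
  fix X Y Z :: "'a bmat"
  define e where "e i l j = (if (i = None) \<noteq> (l = None) \<and> (l = None) \<noteq> (j = None) then -1 else (1::complex))"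
    for i l j :: "'a option"
  define s where "s i = (if i = None then 1 else -1 :: complex)" for i :: "'a option"
  have sign: "s i * e i l j = s l * e j i l" for i j l
    by (auto simp: s_def e_def)
  have "supertrace (supercommutator X Y ** Z)
      = (\<Sum>i\<in>UNIV. \<Sum>j\<in>UNIV. \<Sum>l\<in>UNIV. s i * (X $ i $ l * Y $ l $ j * Z $ j $ i))
       - (\<Sum>i\<in>UNIV. \<Sum>j\<in>UNIV. \<Sum>l\<in>UNIV. s i * e i l j * (Y $ i $ l * X $ l $ j * Z $ j $ i))"
    by (simp add: supertrace_mult supercommutator_nth sum_distrib_left sum_distrib_right
        mult.assoc mult.left_commute right_diff_distrib left_diff_distrib sum_subtractf s_def[abs_def] e_def[abs_def])
  also have "(\<Sum>i\<in>UNIV. \<Sum>j\<in>UNIV. \<Sum>l\<in>UNIV. s i * (X $ i $ l * Y $ l $ j * Z $ j $ i))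
      = (\<Sum>i\<in>UNIV. \<Sum>j\<in>UNIV. \<Sum>l\<in>UNIV. s i * (X $ i $ j * Y $ j $ l * Z $ l $ i))"
    by (rule sum.cong[OF refl]) (rule sum.swap)
  also have "(\<Sum>i\<in>UNIV. \<Sum>j\<in>UNIV. \<Sum>l\<in>UNIV. s i * e i l j * (Y $ i $ l * X $ l $ j * Z $ j $ i))
     = (\<Sum>i\<in>UNIV. \<Sum>j\<in>UNIV. \<Sum>l\<in>UNIV. s l * e j i l * (Y $ i $ l * X $ l $ j * Z $ j $ i))"
    by (intro sum.cong refl arg_cong2[where f = "(*)"] sign)
  also have "\<dots> = (\<Sum>j\<in>UNIV. \<Sum>i\<in>UNIV. \<Sum>l\<in>UNIV. s l * e j i l * (Y $ i $ l * X $ l $ j * Z $ j $ i))"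
    by (rule sum.swap)
  also have "\<dots> = (\<Sum>j\<in>UNIV. \<Sum>l\<in>UNIV. \<Sum>i\<in>UNIV. s l * e j i l * (Y $ i $ l * X $ l $ j * Z $ j $ i))"
    by (rule sum.cong[OF refl]) (rule sum.swap)
  also have "\<dots> = (\<Sum>l\<in>UNIV. \<Sum>j\<in>UNIV. \<Sum>i\<in>UNIV. s l * e j i l * (Y $ i $ l * X $ l $ j * Z $ j $ i))"
    by (rule sum.swap)
  also have "(\<Sum>i\<in>UNIV. \<Sum>j\<in>UNIV. \<Sum>l\<in>UNIV. s i * (X $ i $ j * Y $ j $ l * Z $ l $ i))
    - (\<Sum>l\<in>UNIV. \<Sum>j\<in>UNIV. \<Sum>i\<in>UNIV. s l * e j i l * (Y $ i $ l * X $ l $ j * Z $ j $ i))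
    = supertrace (X ** supercommutator Y Z)"
    by (simp add: supertrace_mult supercommutator_nth sum_distrib_left sum_distrib_right
        mult.assoc mult.left_commute mult.commute right_diff_distrib left_diff_distrib sum_subtractf s_def[abs_def] e_def[abs_def] cong: if_cong)
  finally show "supertrace (supercommutator X Y ** Z) = supertrace (X ** supercommutator Y Z)" .
qed

text \<open>The grading $\mathfrak g = \mathfrak g_{-1} \oplus \mathfrak g_0 \oplus \mathfrak g_1$ by column, diagonal and
  row blocks. It refines the parity, so that all signs can be read off from charges.\<close>

lift_definition charge :: "int \<Rightarrow> 'n::finite sl1 \<Rightarrow> bool" is
  "\<lambda>c X. \<forall>i j. X $ i $ j = 0 \<or> c = of_bool (i = None) - of_bool (j = None)" .

text \<open>The sign that a homogeneous element of parity \<open>p\<close> picks up when it passes \<open>x\<close>,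
  extended linearly: dual bases are not assumed to consist of homogeneous elements.\<close>

lift_definition parity_twist :: "bool \<Rightarrow> 'n::finite sl1 \<Rightarrow> 'n sl1" is
  "\<lambda>p X. \<chi> i j. (if p \<and> (i = None) \<noteq> (j = None) then -1 else 1) * X $ i $ j"
  by (auto simp: supertrace_def)

lemma charge_even: "charge c x \<Longrightarrow> even c \<Longrightarrow> sl_even x"
proof (transfer, goal_cases)
  case (1 c X)
  have c: "X $ i $ j = 0 \<or> c = of_bool (i = None) - of_bool (j = None)" for i j
    using 1(2) by blast
  show ?case unfolding vec_eq_iff
  proof (intro allI)
    fix i j
    show "odd_part X $ i $ j = 0 $ i $ j"
      using c[of i j] 1(3) by (auto simp: odd_part_def split: if_splits)
  qed
qed

lemma charge_odd: "charge c x \<Longrightarrow> odd c \<Longrightarrow> sl_odd x"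
proof (transfer, goal_cases)
  case (1 c X)
  have c: "X $ i $ j = 0 \<or> c = of_bool (i = None) - of_bool (j = None)" for i j
    using 1(2) by blast
  show ?case unfolding vec_eq_iff
  proof (intro allI)
    fix i j
    show "even_part X $ i $ j = 0 $ i $ j"
      using c[of i j] 1(3) by (auto simp: even_part_def split: if_splits)
  qed
qed

lemma sl_form_swap: "charge c x \<Longrightarrow> sl_form x y = (if odd c then -1 else 1) * sl_form y x"
proof (transfer, goal_cases)
  case (1 c X Y)
  have c: "X $ i $ j = 0 \<or> c = of_bool (i = None) - of_bool (j = None)" for i j
    using 1(2) by blast
  have "supertrace (X ** Y) = (\<Sum>i\<in>UNIV. \<Sum>l\<in>UNIV. (if odd c then -1 else 1) * ((if l = None then 1 else -1) * (Y $ l $ i * X $ i $ l)))"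
    unfolding supertrace_mult
  proof (intro sum.cong refl, goal_cases)
    case (1 i l)
    then show ?case using c[of i l] by (auto split: if_splits)
  qed
  also have "\<dots> = (if odd c then -1 else 1) * supertrace (Y ** X)"
    unfolding supertrace_mult sum_distrib_left by (rule sum.swap)
  finally show ?case by simp
qed

lemma sl_form_charge: "charge c x \<Longrightarrow> charge c' y \<Longrightarrow> c + c' \<noteq> 0 \<Longrightarrow> sl_form x y = 0"
proof (transfer, goal_cases)
  case (1 c X c' Y)
  have *: "X $ i $ l * Y $ l $ i = 0" for i l
  proof (rule ccontr)
    assume "X $ i $ l * Y $ l $ i \<noteq> 0"
    then have "c = of_bool (i = None) - of_bool (l = None)" "c' = of_bool (l = None) - of_bool (i = None)"
      using 1(2,4) by (metis mult_zero_left, metis mult_zero_right)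
    then show False using 1(5) by linarith
  qed
  show ?case unfolding supertrace_mult * by simp
qed

lemma charge_bracket: "charge c x \<Longrightarrow> charge c' y \<Longrightarrow> charge (c + c') (sl_bracket x y)"
proof (transfer, goal_cases)
  case (1 c X c' Y)
  have "supercommutator X Y $ i $ j = 0" if "of_bool (i = None) - of_bool (j = None) \<noteq> c + c'" for i j
  proof -
    have *: "X $ i $ l * Y $ l $ j = 0" "Y $ i $ l * X $ l $ j = 0" for l
    proof -
      show "X $ i $ l * Y $ l $ j = 0"
      proof (rule ccontr)
        assume "\<not> ?thesis"
        then have "c = of_bool (i = None) - of_bool (l = None)" "c' = of_bool (l = None) - of_bool (j = None)"
          using 1(2,4) by (metis mult_zero_left, metis mult_zero_right)
        then show False using that by linarith
      qed
      show "Y $ i $ l * X $ l $ j = 0"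
      proof (rule ccontr)
        assume "\<not> ?thesis"
        then have "c' = of_bool (i = None) - of_bool (l = None)" "c = of_bool (l = None) - of_bool (j = None)"
          using 1(2,4) by (metis mult_zero_left, metis mult_zero_right)
        then show False using that by linarith
      qed
    qed
    show ?thesis unfolding supercommutator_nth * by simp
  qed
  then show ?case by metis
qed

lemma charge_cases: assumes "charge c x" "x \<noteq> 0" shows "c = -1 \<or> c = 0 \<or> c = 1"
proof (rule ccontr)
  assume c: "\<not> ?thesis"
  from assms(1) have "x = 0"
  proof (transfer fixing: c, goal_cases)
    case (1 X)
    have "X $ i $ j = 0" for i j
      using 1(2)[rule_format, of i j] c by (auto simp: of_bool_def split: if_splits)
    then show ?case by (simp add: vec_eq_iff)
  qed
  with assms(2) show False by simp
qed

text \<open>The bracket would have charge $\pm 2$, which does not occur. Thus all modes of charge $1$ anticommute, and so do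
  those of charge $-1$.\<close>

lemma sl_bracket_same_charge: assumes "charge c x" "charge c y" "c \<noteq> 0" shows "sl_bracket x y = 0"
proof (rule ccontr)
  assume 1: "sl_bracket x y \<noteq> 0"
  have "x \<noteq> 0"
  proof
    assume "x = 0"
    then show False using 1 sl_bracket_add_left[of 0 0 y] by simp
  qed
  then have "c = -1 \<or> c = 1" using charge_cases assms by blast
  moreover have "c + c = -1 \<or> c + c = 0 \<or> c + c = 1" using charge_cases[OF charge_bracket[OF assms(1,2)] 1] .
  ultimately show False by auto
qed

lemma charge_decomposition:
  obtains x0 x1 x2 where "charge (-1) x0" "charge 0 x1" "charge 1 x2" "x = x0 + x1 + x2"
proof -
  have "\<exists>x0 x1 x2. charge (-1) x0 \<and> charge 0 x1 \<and> charge 1 x2 \<and> x = x0 + x1 + x2"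
  proof (transfer, goal_cases)
    case (1 X)
    show ?case
      by (rule bexI[of _ "\<chi> i j. if i \<noteq> None \<and> j = None then X $ i $ j else 0"],
          rule bexI[of _ "\<chi> i j. if (i = None) = (j = None) then X $ i $ j else 0"],
          rule bexI[of _ "\<chi> i j. if i = None \<and> j \<noteq> None then X $ i $ j else 0"])
        (use 1 in \<open>auto simp: vec_eq_iff supertrace_def\<close>)
  qed
  then show ?thesis using that by blast
qed

text \<open>The central element of $\mathfrak g_0 = \mathfrak{gl}_n$, normalised so that it acts on
  $\mathfrak g_c$ as $c$.\<close>

lift_definition central_elt :: "'n::finite sl1" is
  "(\<chi> i j. if i = j then (if i = None then of_nat CARD('n) else 1) / of_nat (CARD('n) - 1) else 0)"
  by (simp add: supertrace_def)

lemma central_elt_charge: "charge 0 central_elt"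
  by transfer auto

lemma central_elt_bracket:
  fixes x :: "'n::finite sl1"
  assumes "CARD('n) \<ge> 2" "charge c x"
  shows "sl_bracket central_elt x = sl_scale (of_int c) x"
  using assms(2)
proof (transfer, goal_cases)
  case (1 c X)
  define N :: complex where "N = of_nat (CARD('n) - 1)"
  have n: "N \<noteq> 0" using assms by (simp add: N_def)
  have n': "of_nat CARD('n) = N + 1"
    using assms(1) by (simp add: of_nat_diff N_def)
  define d :: "'n option \<Rightarrow> complex" where "d i = (if i = None then N + 1 else 1) / N" for i
  have eq: "(\<chi> i j. if i = j then (if i = None then of_nat CARD('n) else 1) / of_nat (CARD('n) - 1) else 0)
    = (\<chi> i j. if i = j then d i else 0)"
    unfolding d_def n' N_def[symmetric] ..
  have d1: "(N + 1) / N - 1 / N = 1"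
    using n by (simp add: diff_divide_distrib[symmetric])
  have d2: "1 / N - (N + 1) / N = - 1"
    using n by (simp add: diff_divide_distrib[symmetric])
  show ?case unfolding vec_eq_iff eq
  proof (intro allI)
    fix i j
    have "supercommutator (\<chi> i j. if i = j then d i else 0) X $ i $ j
      = (\<Sum>l\<in>UNIV. (if l = i then d i * X $ i $ j else 0) - (if l = j then X $ i $ j * d j else 0))"
      unfolding supercommutator_nth by (intro sum.cong refl) auto
    also have "\<dots> = (d i - d j) * X $ i $ j"
      by (simp add: sum_subtractf left_diff_distrib)
    also have "\<dots> = of_int c * X $ i $ j"
    proof (cases "X $ i $ j = 0")
      case False
      then have "c = of_bool (i = None) - of_bool (j = None)" using 1(2) by blast
      then have "d i - d j = of_int c"
        using d1 d2 by (cases "i = None"; cases "j = None") (auto simp: d_def simp del: not_None_eq)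
      then show ?thesis by simp
    qed simp
    finally show "supercommutator (\<chi> i j. if i = j then d i else 0) X $ i $ j = (\<chi> i j. of_int c * X $ i $ j) $ i $ j" by simp
  qed
qed

lemma central_elt_norm:
  assumes "CARD('n::finite) \<ge> 2"
  shows "sl_form (central_elt :: 'n sl1) central_elt = - (of_nat CARD('n) / of_nat (CARD('n) - 1))"
proof (transfer, goal_cases)
  case 1
  define N :: complex where "N = of_nat (CARD('n) - 1)"
  have n: "N \<noteq> 0" using assms by (simp add: N_def)
  have n': "of_nat CARD('n) = N + 1"
    using assms(1) by (simp add: of_nat_diff N_def)
  define d :: "'n option \<Rightarrow> complex" where "d i = (if i = None then N + 1 else 1) / N" for i
  have eq: "(\<chi> i j. if i = j then (if i = None then of_nat CARD('n) else 1) / of_nat (CARD('n) - 1) else 0)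
    = (\<chi> i j. if i = j then d i else 0)"
    unfolding d_def n' N_def[symmetric] ..
  have sq: "(\<chi> i j. if i = j then d i else 0) ** (\<chi> i j. if i = j then d i else 0)
      = (\<chi> i j. if i = j then (d i)\<^sup>2 else 0)"
  proof -
    have "(\<Sum>l\<in>UNIV. (if i = l then d i else 0) * (if l = j then d l else 0))
        = (\<Sum>l\<in>UNIV. if l = i then (if i = j then (d i)\<^sup>2 else 0) else 0)" for i j
      by (rule sum.cong) (auto simp: power2_eq_square)
    then show ?thesis by (simp add: vec_eq_iff matrix_matrix_mult_def)
  qed
  have "- supertrace (\<chi> i j. if i = j then (d i)\<^sup>2 else 0)
    = - (((N + 1) / N)\<^sup>2 - (N + 1) * (1 / N)\<^sup>2)"
    unfolding supertrace_def by (simp add: d_def n')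
  moreover have "- (((N + 1) / N)\<^sup>2 - (N + 1) * (1 / N)\<^sup>2) = - ((N + 1) / N)"
  proof -
    have "((N + 1) / N)\<^sup>2 - (N + 1) * (1 / N)\<^sup>2 = (N + 1) / N * ((N + 1) / N - 1 / N)"
      by (simp add: power2_eq_square right_diff_distrib)
    also have "(N + 1) / N - 1 / N = 1"
      using n by (simp add: diff_divide_distrib[symmetric])
    finally show ?thesis by simp
  qed
  ultimately show ?case unfolding eq sq unfolding n' N_def[symmetric] by (rule trans)
qed

lemma sl_bracket_zero: "sl_bracket 0 x = 0" "sl_bracket x 0 = 0"
  using sl_bracket_add_left[of 0 0 x] sl_bracket_add_right[of x 0 0] by auto

lemma sl_form_zero: "sl_form 0 x = 0" "sl_form x 0 = 0"
  using sl_form_add_left[of 0 0 x] sl_form_add_right[of x 0 0] by auto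

lemma sl_form_sum_left: "sl_form (sum f A) y = (\<Sum>i\<in>A. sl_form (f i) y)"
  by (induction A rule: infinite_finite_induct) (auto simp: sl_form_zero sl_form_add_left)

lemma sl_form_sum_right: "sl_form y (sum f A) = (\<Sum>i\<in>A. sl_form y (f i))"
  by (induction A rule: infinite_finite_induct) (auto simp: sl_form_zero sl_form_add_right)

lemma parity_twist_add: "parity_twist p (x + y) = parity_twist p x + parity_twist p y"
  by transfer (simp add: vec_eq_iff algebra_simps)

lemma parity_twist_scale: "parity_twist p (sl_scale c x) = sl_scale c (parity_twist p x)"
  by transfer (simp add: vec_eq_iff)

lemma parity_twist_zero: "parity_twist p 0 = 0"
  using parity_twist_add[of p 0 0] by simp

lemma parity_twist_sum: "parity_twist p (sum f A) = (\<Sum>i\<in>A. parity_twist p (f i))"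
  by (induction A rule: infinite_finite_induct) (auto simp: parity_twist_zero parity_twist_add)

lemma parity_twist_charge:
  "charge c x \<Longrightarrow> parity_twist p x = sl_scale (super_sign p (odd c)) x"
proof (transfer, goal_cases)
  case (1 c X p)
  have "(if p \<and> (i = None) \<noteq> (j = None) then -1 else 1) * X $ i $ j = super_sign p (odd c) * X $ i $ j" for i j
    using 1(2)[rule_format, of i j] by (auto simp: super_sign_def of_bool_def split: if_splits)
  then show ?case by (simp add: vec_eq_iff)
qed

lemma dual_bases_expand:
  assumes "dual_bases d a b"
  shows "x = (\<Sum>i<d. sl_scale (sl_form (b i) x) (a i))" "x = (\<Sum>i<d. sl_scale (sl_form x (a i)) (b i))"
proof -
  have dual: "sl_form (b i) (a j) = (if i = j then 1 else 0)" if "i < d" "j < d" for i j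
    using assms that by (simp add: dual_bases_def)
  have "x \<in> sl.span (a ` {..<d})" "inj_on a {..<d}" using assms by (auto simp: dual_bases_def)
  then obtain u where u: "x = (\<Sum>i<d. sl_scale (u i) (a i))"
    by (auto simp: sl.span_finite sum.reindex)
  have "sl_form (b j) x = u j" if "j < d" for j
    by (simp add: u sl_form_sum_right sl_form_scale_right dual that if_distrib[of "\<lambda>x. _ * x"] cong: if_cong)
  then show "x = (\<Sum>i<d. sl_scale (sl_form (b i) x) (a i))"
    by (subst u) (rule sum.cong, auto)
  have "x \<in> sl.span (b ` {..<d})" "inj_on b {..<d}" using assms by (auto simp: dual_bases_def)
  then obtain u where u: "x = (\<Sum>i<d. sl_scale (u i) (b i))"
    by (auto simp: sl.span_finite sum.reindex)
  have "sl_form x (a j) = u j" if "j < d" for j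
    by (simp add: u sl_form_sum_left sl_form_scale_left dual that if_distrib[of "\<lambda>x. _ * x"] cong: if_cong)
  then show "x = (\<Sum>i<d. sl_scale (sl_form x (a i)) (b i))"
    by (subst u) (rule sum.cong, auto)
qed

text \<open>The Coxeter number is defined by $\sum_i [a^i, [b^i, x]]$. Pairing with $y$ and moving both brackets to
  the other side by invariance transforms this sum for $y$ into the present one for $x$, whatever the
  parities of the basis vectors are.\<close>

lemma casimir_right:
  fixes x :: "'n::finite sl1"
  assumes "dual_bases d a b" "is_dual_coxeter_number TYPE('n) h"
  shows "(\<Sum>i<d. sl_bracket (sl_bracket x (a i)) (b i)) = sl_scale (2 * h) x" (is "?t = _")
proof -
  have "sl_form ?t y = sl_form (sl_scale (2 * h) x) y" for y
  proof -
    have "sl_form ?t y = sl_form x (\<Sum>i<d. sl_bracket (a i) (sl_bracket (b i) y))"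
      by (simp add: sl_form_sum_left sl_form_sum_right sl_form_invariant)
    also have "\<dots> = sl_form (sl_scale (2 * h) x) y"
      using assms by (simp add: is_dual_coxeter_number_def sl_form_scale_left sl_form_scale_right)
    finally show ?thesis .
  qed
  then show ?thesis
    using dual_bases_expand(2)[OF assms(1), of ?t] dual_bases_expand(2)[OF assms(1), of "sl_scale (2 * h) x"]
    by simp
qed

lemma finite_charge_spanning:
  fixes a b :: "nat \<Rightarrow> 'n::finite sl1"
  assumes "dual_bases d a b"
  obtains S where "finite S" "\<And>x. x \<in> S \<Longrightarrow> charge c x" "\<And>x :: 'n sl1. charge c x \<Longrightarrow> x \<in> sl.span S"
proof -
  obtain S where S: "S \<subseteq> {x :: 'n sl1. charge c x}" "sl.independent S" "{x. charge c x} \<subseteq> sl.span S"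
    by (rule sl.maximal_independent_subset)
  have "sl.span (a ` {..<d}) = UNIV" using assms by (simp add: dual_bases_def)
  then have "finite S"
    using sl.independent_span_bound[OF _ S(2), of "a ` {..<d}"] by simp
  then show thesis using S that by blast
qed

section \<open>The affine action on a quotient of the vacuum module\<close>

lemma aff_scale_mode: "aff_scale c (mode x m) = mode (sl_scale c x) m"
proof -
  have "sl_scale c 0 = (0 :: 'a sl1)" by (rule sl.scale_zero_right)
  then show ?thesis by (simp add: aff_scale_def mode_def map_single)
qed

lemma mode_add: "mode (x + y) m = mode x m + mode y m"
  by (simp add: mode_def single_add)

lemma aff_scale_one: "aff_scale 1 x = x"
  by (auto simp: aff_scale_def prod_eq_iff intro!: poly_mapping_eqI simp: Poly_Mapping.map.rep_eq when_def)

lemma aff_bracket_mode: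
  "aff_bracket (mode x m) (mode y l)
     = mode (sl_bracket x y) (m + l) + (0, if m + l = 0 then of_int m * sl_form x y else 0)"
  by (auto simp: aff_bracket_def mode_def sl_bracket_zero sl_form_zero)

lemma aff_homogeneous_mode:
  assumes "charge c x" shows "aff_homogeneous (odd c) (mode x m)"
proof -
  have "sl_even (0 :: 'a sl1)" "sl_odd (0 :: 'a sl1)"
    by (transfer, simp add: odd_part_def even_part_def vec_eq_iff)+
  then show ?thesis using charge_even[OF assms] charge_odd[OF assms]
    by (auto simp: aff_homogeneous_def mode_def lookup_single when_def)
qed

text \<open>Reduces stability of a subspace under $\hat{\mathfrak g}$ to stability under $K$ and the modes of
  homogeneous elements, to which the defining relations of the enveloping algebra apply.\<close>

lemma affine_induct [case_names central mode add]:
  assumes "\<And>c. P (0, c)" "\<And>c x m. charge c x \<Longrightarrow> P (mode x m)" "\<And>x y. P x \<Longrightarrow> P y \<Longrightarrow> P (x + y)"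
  shows "P (y :: 'n::finite affine)"
proof -
  have mode: "P (mode x m)" for x :: "'n sl1" and m
    by (rule charge_decomposition[of x]) (auto simp: mode_add intro!: assms(2,3))
  obtain f c where y: "y = (f, c)" by (cases y)
  have "finite K \<Longrightarrow> P (\<Sum>m\<in>K. mode (Poly_Mapping.lookup f m) m)" for K
  proof (induction K rule: finite_induct)
    case empty
    then show ?case using assms(1)[of 0] by (simp add: zero_prod_def)
  qed (simp add: assms(3) mode)
  moreover have "y = (\<Sum>m\<in>Poly_Mapping.keys f. mode (Poly_Mapping.lookup f m) m) + (0, c)"
  proof -
    have "fst (\<Sum>m\<in>Poly_Mapping.keys f. mode (Poly_Mapping.lookup f m) m) = f"
      by (intro poly_mapping_eqI)
        (simp add: fst_sum mode_def lookup_sum lookup_single when_def in_keys_iff)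
    moreover have "snd (\<Sum>m\<in>Poly_Mapping.keys f. mode (Poly_Mapping.lookup f m) m) = 0"
      by (simp add: snd_sum mode_def)
    ultimately show ?thesis by (simp add: y prod_eq_iff)
  qed
  ultimately show ?thesis using assms(1,3) by (metis finite_keys)
qed

context irreducible_vk_quotient
begin

text \<open>Calculations are done with representatives in the free algebra; this is the map from it onto the module.\<close>

definition cls :: "'n free_alg \<Rightarrow> 'v" where
  "cls u = proj (vk_class k u)"

lemma subspace_vk_ideal: "fa.subspace (vk_ideal k)"
  unfolding vk_ideal_def by (rule fa.subspace_span)

lemma vk_class_eq: "u - v \<in> vk_ideal k \<Longrightarrow> vk_class k u = vk_class k v"
proof -
  assume uv: "u - v \<in> vk_ideal k"
  have "u - w \<in> vk_ideal k \<longleftrightarrow> v - w \<in> vk_ideal k" for w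
    using fa.subspace_diff[OF subspace_vk_ideal _ uv, of "u - w"]
      fa.subspace_add[OF subspace_vk_ideal _ uv, of "v - w"] by auto
  then show ?thesis by (auto simp: vk_class_def vk_rel_def)
qed

lemma cls_add: "cls (u + v) = cls u + cls v"
  by (simp add: cls_def proj_add)

lemma cls_scale: "cls (fa_scale c u) = scale c (cls u)"
  by (simp add: cls_def proj_scale)

lemma cls_act: "cls (gen x * u) = act x (cls u)"
  by (simp add: cls_def proj_act)

lemma cls_diff: "cls (u - v) = cls u - cls v"
  using cls_add[of "u - v" v] by simp

lemma cls_surj: "\<exists>u. v = cls u"
proof -
  have "v \<in> proj ` vk_module k" using proj_surj by simp
  then show ?thesis by (auto simp: vk_module_def quotient_def cls_def vk_class_def)
qed

lemma cls_ideal: "u \<in> vk_ideal k \<Longrightarrow> cls u = 0"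
  using vk_class_eq[of u 0] cls_scale[of 0 0] by (simp add: cls_def)

lemma cls_enveloping: "r \<in> enveloping_relations \<Longrightarrow> cls (r * u) = 0"
proof (rule cls_ideal)
  assume "r \<in> enveloping_relations"
  then have "1 * r * u \<in> enveloping_ideal"
    unfolding enveloping_ideal_def by (intro fa.span_base) blast
  then show "r * u \<in> vk_ideal k"
    unfolding vk_ideal_def by (intro fa.span_base) simp
qed

lemma fa_scale_mult: "fa_scale c u * v = fa_scale c (u * v)"
  by (simp add: fa_scale_def mult.assoc)

lemma gen_fa_scale: "gen x * fa_scale c u = fa_scale c (gen x * u)"
  by (simp add: fa_scale_def gen_def mult_single flip: mult.assoc)

lemma act_add: "act x (v + w) = act x v + act x w"
  using cls_surj[of v] cls_surj[of w] by (metis cls_act cls_add distrib_left)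

lemma act_scale: "act x (scale c v) = scale c (act x v)"
  using cls_surj[of v] by (metis cls_act cls_scale gen_fa_scale)

lemma act_linear: "act (aff_scale c x + y) v = scale c (act x v) + act y v"
proof -
  obtain u where u: "v = cls u" using cls_surj by blast
  have "cls ((gen (aff_scale c x + y) - (fa_scale c (gen x) + gen y)) * u) = 0"
    by (rule cls_enveloping) (unfold enveloping_relations_def, blast)
  then show ?thesis
    by (simp add: left_diff_distrib distrib_right cls_diff cls_add cls_scale cls_act fa_scale_mult u)
qed

lemma act_add_left: "act (x + y) v = act x v + act y v"
  using act_linear[of 1 x y v] by (simp add: aff_scale_one)

lemma act_zero_left: "act 0 v = 0"
  using act_add_left[of 0 0 v] by simp

lemma act_scale_left: "act (aff_scale c x) v = scale c (act x v)"
  using act_linear[of c x 0 v] by (simp add: act_zero_left)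

lemma act_commute:
  assumes "aff_homogeneous p x" "aff_homogeneous q y"
  shows "act x (act y v) = scale (super_sign p q) (act y (act x v)) + act (aff_bracket x y) v"
proof -
  obtain u where u: "v = cls u" using cls_surj by blast
  have "cls ((gen x * gen y - fa_scale (super_sign p q) (gen y * gen x) - gen (aff_bracket x y)) * u) = 0"
    by (rule cls_enveloping) (use assms in \<open>unfold enveloping_relations_def, blast\<close>)
  then show ?thesis
    by (simp add: left_diff_distrib cls_diff cls_scale cls_act fa_scale_mult mult.assoc u diff_eq_eq add.commute)
qed

lemma act_vacuum: "y \<in> aff_nonneg \<Longrightarrow> act y (cls 1) = scale (k * snd y) (cls 1)"
proof -
  assume "y \<in> aff_nonneg"
  then have "1 * (gen y - fa_scale (k * snd y) 1) \<in> vk_ideal k"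
    unfolding vk_ideal_def by (intro fa.span_base UnI2) blast
  then have "cls (gen y * 1 - fa_scale (k * snd y) 1) = 0"
    by (intro cls_ideal) simp
  then show ?thesis by (simp only: cls_diff cls_scale cls_act) simp
qed

lemma invariant_subspace_UNIV:
  assumes "subspace W" "W \<noteq> {0}"
    and central: "\<And>c v. v \<in> W \<Longrightarrow> act (0, c) v \<in> W"
    and mode: "\<And>c x m v. charge c x \<Longrightarrow> v \<in> W \<Longrightarrow> act (mode x m) v \<in> W"
  shows "W = UNIV"
proof -
  have "act y v \<in> W" if "v \<in> W" for y v
    by (induction y rule: affine_induct)
      (use that central mode assms(1) in \<open>auto simp: act_add_left subspace_add\<close>)
  then show ?thesis using irreducible[OF assms(1)] assms(2) by blast
qed

text \<open>If the vacuum vanished, every word applied to it would vanish, and so would the whole quotient.\<close>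

lemma cls_one_nonzero: "cls 1 \<noteq> 0"
proof
  assume 0: "cls 1 = 0"
  have act0: "act x 0 = 0" for x
    using act_add[of x 0 0] by simp
  have word: "cls (Poly_Mapping.single (Word xs) 1) = 0" for xs
  proof (induction xs)
    case Nil
    then show ?case using 0 by (simp add: zero_word_def[symmetric])
  next
    case (Cons x xs)
    have "(Poly_Mapping.single (Word (x # xs)) 1 :: 'n free_alg) = gen x * Poly_Mapping.single (Word xs) 1"
      by (simp add: gen_def mult_single)
    then show ?case using Cons by (simp add: cls_act act0)
  qed
  have "cls (\<Sum>w\<in>K. Poly_Mapping.single w (Poly_Mapping.lookup u w)) = 0" if "finite K" for K u
    using that
  proof (induction K rule: finite_induct)
    case empty
    then show ?case using cls_add[of 0 0] by simp
  next
    case (insert w K)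
    have "Poly_Mapping.single w c = fa_scale c (Poly_Mapping.single w 1)" for c
      by (simp add: fa_scale_def mult_single)
    then have "cls (Poly_Mapping.single w c) = 0" for c
      by (metis cls_scale word word.exhaust scale_zero_right)
    with insert show ?case by (simp add: cls_add)
  qed
  moreover have "u = (\<Sum>w\<in>Poly_Mapping.keys u. Poly_Mapping.single w (Poly_Mapping.lookup u w))" for u :: "'n free_alg"
    by (intro poly_mapping_eqI) (simp add: lookup_sum lookup_single when_def in_keys_iff)
  ultimately have "cls u = 0" for u by (metis finite_keys)
  then show False using nontrivial cls_surj by metis
qed

text \<open>$K$ commutes with everything and is $k$ on the vacuum, so the vectors on which it is $k$ form a nonzero
  submodule.\<close>

lemma act_central: "act (0, c) v = scale (k * c) v"
proof -
  let ?W = "{v. act (0, c) v = scale (k * c) v}"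
  have "?W = UNIV"
  proof (rule invariant_subspace_UNIV)
    show "subspace ?W"
      using act_scale[of _ 0 0]
      by (auto simp: subspace_def act_add act_scale scale_right_distrib scale_left_commute)
    have vac: "cls 1 \<in> ?W" using act_vacuum[of "(0, c)"] by (simp add: aff_nonneg_def)
    then show "?W \<noteq> {0}" using cls_one_nonzero by blast
    have even: "aff_homogeneous False (0 :: int \<Rightarrow>\<^sub>0 'n sl1, c)" for c
    proof -
      have "sl_even (0 :: 'n sl1)" by transfer (simp add: odd_part_def vec_eq_iff)
      then show ?thesis by (simp add: aff_homogeneous_def)
    qed
    have bracket: "aff_bracket (0 :: int \<Rightarrow>\<^sub>0 'n sl1, c) y = 0" for c y
      by (simp add: aff_bracket_def zero_prod_def)
    show "act (0, c') v \<in> ?W" if "v \<in> ?W" for c' v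
      using act_commute[OF even even, of c c' v] that by (simp add: super_sign_def bracket act_zero_left act_scale)
    show "act (mode x m) v \<in> ?W" if "charge c' x" "v \<in> ?W" for c' x m v
      using act_commute[OF even aff_homogeneous_mode[OF that(1)], of c m v] that
      by (simp add: super_sign_def bracket act_zero_left act_scale)
  qed
  then show ?thesis by auto
qed

lemma generated_by_vacuum:
  assumes "subspace W" "cls 1 \<in> W"
    and "\<And>c x m v. charge c x \<Longrightarrow> v \<in> W \<Longrightarrow> act (mode x m) v \<in> W"
  shows "W = UNIV"
  by (rule invariant_subspace_UNIV)
    (use assms cls_one_nonzero in \<open>auto simp: act_central subspace_scale\<close>)

lemma act_mode_commute:
  assumes "charge c x" "charge d y"
  shows "act (mode x m) (act (mode y l) v)
     = scale (super_sign (odd c) (odd d)) (act (mode y l) (act (mode x m) v))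
       + act (mode (sl_bracket x y) (m + l)) v
       + scale (if m + l = 0 then of_int m * sl_form x y * k else 0) v"
  by (subst act_commute[OF assms[THEN aff_homogeneous_mode]])
    (simp add: aff_bracket_mode act_add_left act_central add.assoc algebra_simps)

end

section \<open>Finite sums and graded linear algebra\<close>

lemma Sum_any_eq_single: "(\<And>i. i \<noteq> j \<Longrightarrow> f i = 0) \<Longrightarrow> Sum_any f = f j"
  by (subst Sum_any.expand_superset[of "{j}"]) auto

lemma Sum_any_eq_atMost: "(\<And>i. i > n \<Longrightarrow> f i = 0) \<Longrightarrow> Sum_any f = sum f {..n::nat}"
  by (subst Sum_any.expand_superset[of "{..n}"]) (auto simp: not_le[symmetric])

lemma sum_triangle_swap:
  "(\<Sum>j\<le>n::nat. \<Sum>t\<le>n - j. f j t) = (\<Sum>t\<le>n. \<Sum>j\<le>n - t. f j t)"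
  unfolding sum.Sigma[OF finite_atMost ballI[OF finite_atMost]]
  by (rule sum.reindex_bij_witness[of _ "\<lambda>(a, b). (b, a)" "\<lambda>(a, b). (b, a)"]) auto

lemma sum_triangle_diagonal:
  "(\<Sum>j\<le>n::nat. \<Sum>t\<le>n - j. f j t) = (\<Sum>p\<le>n. \<Sum>t\<le>p. f (p - t) t)"
  unfolding sum.Sigma[OF finite_atMost ballI[OF finite_atMost]]
  by (rule sum.reindex_bij_witness[of _ "\<lambda>(p, t). (p - t, t)" "\<lambda>(j, t). (j + t, t)"]) auto

text \<open>The coefficient identity behind $y \frac{d}{dy} (1+y)^z = zy(1+y)^{-1}(1+y)^z$.\<close>

lemma gbinomial_alternating_sum:
  fixes z :: complex
  shows "(\<Sum>t\<le>p. (-1) ^ (p - t) * (z gchoose t)) * z = of_nat (Suc p) * (z gchoose Suc p)"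
proof -
  have "(\<Sum>t\<le>p. (-1) ^ (p - t) * (z gchoose t)) = (-1) ^ p * (\<Sum>t\<le>p. (z gchoose t) * (-1) ^ t)"
    unfolding sum_distrib_left
  proof (rule sum.cong[OF refl])
    fix t assume "t \<in> {..p}"
    then have "(-1) ^ p = (-1) ^ (p - t) * (-1 :: complex) ^ t" by (simp flip: power_add)
    then show "(-1) ^ (p - t) * (z gchoose t) = (-1) ^ p * ((z gchoose t) * (-1) ^ t)"
      by (simp add: power_mult_distrib[symmetric] mult.assoc)
  qed
  also have "\<dots> = (z - 1 gchoose p)"
    by (simp add: gbinomial_sum_lower_neg flip: power_add mult.assoc power_mult_distrib)
  also have "\<dots> * z = of_nat (Suc p) * (z gchoose Suc p)"
    using gbinomial_absorption[of p z] by (simp add: mult.commute)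
  finally show ?thesis .
qed

context vector_space
begin

lemma span_image_subspace:
  assumes "\<And>v w. f (v + w) = f v + f w" "\<And>c v. f (scale c v) = scale c (f v)"
    and "\<And>v. v \<in> S \<Longrightarrow> f v \<in> W" "subspace W" "v \<in> span S"
  shows "f v \<in> W"
  using assms(5)
proof (induction rule: span_induct_alt)
  case base
  have "f 0 = 0" using assms(2)[of 0 0] by simp
  then show ?case using assms(4) by (simp add: subspace_0)
next
  case (step c x y)
  then show ?case using assms by (simp add: subspace_add subspace_scale)
qed

text \<open>Linear maps given separately on the eigenspaces of a diagonalisable operator glue to one linear
  map. This yields the projections onto the conformal weight spaces, and it turns an operation that
  depends on the weight of its argument, such as taking the zero mode, into a linear map.\<close>

lemma eigenspace_linear_extension:
  assumes D: "\<And>v w. D (v + w) = D v + D w" "\<And>c v. D (scale c v) = scale c (D v)"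
    and span: "span {v. \<exists>\<mu>. D v = scale \<mu> v} = UNIV"
    and f: "\<And>\<mu> v w. f \<mu> (v + w) = f \<mu> v + f \<mu> w" "\<And>\<mu> c v. f \<mu> (scale c v) = scale c (f \<mu> v)"
  obtains F where "\<And>v w. F (v + w) = F v + F w" "\<And>c v. F (scale c v) = scale c (F v)"
    "\<And>\<mu> v. D v = scale \<mu> v \<Longrightarrow> F v = f \<mu> v"
proof -
  interpret vector_space_pair scale scale ..
  obtain B where B: "B \<subseteq> {v. \<exists>\<mu>. D v = scale \<mu> v}" "independent B" "{v. \<exists>\<mu>. D v = scale \<mu> v} \<subseteq> span B"
    by (rule maximal_independent_subset)
  have "span B = UNIV" using span span_mono[OF B(3)] by (simp add: span_span) (metis UNIV_eq_I subset_UNIV subset_antisym)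
  define ev where "ev b = (SOME \<mu>. D b = scale \<mu> b)" for b
  have ev: "D b = scale (ev b) b" if "b \<in> B" for b
  proof -
    have "\<exists>\<mu>. D b = scale \<mu> b" using that B(1) by auto
    then show ?thesis unfolding ev_def by (rule someI_ex)
  qed
  define F where "F = construct B (\<lambda>b. f (ev b) b)"
  have lin: "Vector_Spaces.linear scale scale F" unfolding F_def by (rule linear_construct[OF B(2)])
  have FB: "F b = f (ev b) b" if "b \<in> B" for b
    unfolding F_def by (rule construct_basis[OF B(2) that])
  have f0: "f \<mu> 0 = 0" for \<mu> using f(2)[of \<mu> 0 0] by simp
  have fsum: "f \<mu> (sum g A) = (\<Sum>i\<in>A. f \<mu> (g i))" for \<mu> A and g :: "'b \<Rightarrow> 'b"
    by (induction A rule: infinite_finite_induct) (auto simp: f0 f)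
  have D0: "D 0 = 0" using D(2)[of 0 0] by simp
  have Dsum: "D (sum g A) = (\<Sum>i\<in>A. D (g i))" for A and g :: "'b \<Rightarrow> 'b"
    by (induction A rule: infinite_finite_induct) (auto simp: D0 D)
  show thesis
  proof
    show "F (v + w) = F v + F w" for v w using linear_add[OF lin] .
    show "F (scale c v) = scale c (F v)" for c v using linear_scale[OF lin] .
    show "F v = f \<mu> v" if v: "D v = scale \<mu> v" for \<mu> v
    proof -
      have "v \<in> span B" using \<open>span B = UNIV\<close> by simp
      then obtain t r where t: "finite t" "t \<subseteq> B" "v = (\<Sum>b\<in>t. scale (r b) b)"
        by (auto simp: span_explicit)
      have "(\<Sum>b\<in>t. scale (r b * (ev b - \<mu>)) b) = D v - scale \<mu> v"
      proof -
        have "D v = (\<Sum>b\<in>t. scale (r b * ev b) b)"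
          unfolding t(3) Dsum D(2) using t(2) by (intro sum.cong) (auto simp: ev)
        then show ?thesis
          by (simp add: t(3) scale_sum_right right_diff_distrib scale_left_diff_distrib sum_subtractf mult.commute)
      qed
      then have "r b * (ev b - \<mu>) = 0" if "b \<in> t" for b
        using independentD[OF B(2) t(1,2) _ that, of "\<lambda>b. r b * (ev b - \<mu>)"] v by simp
      then have eq: "scale (r b) (f (ev b) b) = scale (r b) (f \<mu> b)" if "b \<in> t" for b
        using that by auto
      have "F v = (\<Sum>b\<in>t. scale (r b) (F b))"
        unfolding t(3) linear_sum[OF lin] linear_scale[OF lin] ..
      also have "\<dots> = (\<Sum>b\<in>t. scale (r b) (f \<mu> b))"
        using t(2) by (intro sum.cong refl) (metis FB eq subsetD)
      also have "\<dots> = f \<mu> v" by (simp add: t(3) fsum f)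
      finally show ?thesis .
    qed
  qed
qed

lemma subspace_Sum_any: "subspace W \<Longrightarrow> (\<And>i. f i \<in> W) \<Longrightarrow> Sum_any f \<in> W"
  unfolding Sum_any.expand_set by (rule subspace_sum)

text \<open>More vectors than the dimension of the ambient space are dependent; repetitions give a relation too.\<close>

lemma linear_relation:
  fixes v :: "nat \<Rightarrow> 'b"
  assumes "finite B" "\<And>i. v i \<in> span B"
  obtains c n where "(\<Sum>i\<le>n. scale (c i) (v i)) = 0" "\<exists>i\<le>n. c i \<noteq> 0"
proof (cases "inj_on v {..card B}")
  case False
  then obtain i j where ij: "i \<le> card B" "j \<le> card B" "i \<noteq> j" "v i = v j" by (auto simp: inj_on_def)
  let ?c = "\<lambda>m. if m = i then 1 else if m = j then -1 else 0 :: 'a"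
  have "(\<Sum>m\<le>card B. scale (?c m) (v m)) = (\<Sum>m\<in>{i, j}. scale (?c m) (v m))"
    by (rule sum.mono_neutral_right) (use ij in auto)
  then show thesis using ij by (intro that[of ?c "card B"]) auto
next
  case True
  have "dependent (v ` {..card B})"
  proof (rule ccontr)
    assume "independent (v ` {..card B})"
    then have "card (v ` {..card B}) \<le> card B"
      using independent_span_bound[OF assms(1), of "v ` {..card B}"] assms(2) by auto
    then show False using True by (simp add: card_image)
  qed
  then obtain u where u: "\<exists>x\<in>v ` {..card B}. u x \<noteq> 0" "(\<Sum>x\<in>v ` {..card B}. scale (u x) x) = 0"
    by (auto simp: dependent_finite)
  show thesis
    by (rule that[of "\<lambda>i. u (v i)" "card B"]) (use u True in \<open>auto simp: sum.reindex\<close>)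
qed

end

section \<open>The Sugawara vector\<close>

text \<open>The data of the theorem, with the affine action reduced to the operators \<open>X x m\<close> for $x(m)$
  and with generation by the vacuum in place of irreducibility.\<close>

locale sl_vosa = vertex_operator_superalgebra scale V Y vac \<omega>
  for scale :: "complex \<Rightarrow> 'v::ab_group_add \<Rightarrow> 'v" and V Y vac \<omega> +
  fixes k d :: nat and h :: complex and X :: "'n::finite sl1 \<Rightarrow> int \<Rightarrow> 'v \<Rightarrow> 'v" and a b :: "nat \<Rightarrow> 'n sl1"
  assumes card: "CARD('n) \<ge> 2"
    and level_pos: "k > 0"
    and X_parity: "charge c x \<Longrightarrow> X x (-1) vac \<in> V (odd c)"
    and X_Y: "Y (X x (-1) vac) m v = X x m v"
    and X_add_left: "X (x + y) m v = X x m v + X y m v"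
    and X_scale_left: "X (sl_scale \<alpha> x) m v = scale \<alpha> (X x m v)"
    and X_commute: "charge c x \<Longrightarrow> charge e y \<Longrightarrow>
      X x m (X y l v) = scale (super_sign (odd c) (odd e)) (X y l (X x m v)) + X (sl_bracket x y) (m + l) v
        + scale (if m + l = 0 then of_int m * sl_form x y * of_nat k else 0) v"
    and generated: "subspace W \<Longrightarrow> vac \<in> W \<Longrightarrow> (\<And>c x m v. charge c x \<Longrightarrow> v \<in> W \<Longrightarrow> X x m v \<in> W) \<Longrightarrow> W = UNIV"
    and vac_nonzero: "vac \<noteq> 0"
    and bases: "dual_bases d a b"
    and coxeter: "is_dual_coxeter_number TYPE('n) h"
    and omega: "\<omega> = scale (1 / (2 * (of_nat k + h))) (\<Sum>i<d. X (a i) (-1) (X (b i) (-1) vac))"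
begin

lemma X_add: "X x m (v + w) = X x m v + X x m w"
  by (metis X_Y Y_add_right)

lemma X_scale: "X x m (scale \<alpha> v) = scale \<alpha> (X x m v)"
  by (metis X_Y Y_scale_right)

lemma X_zero: "X x m 0 = 0"
  using X_scale[of x m 0 0] by simp

lemma X_zero_left: "X 0 m v = 0"
  using X_add_left[of 0 0 m v] by simp

lemma X_sum: "X x m (sum f A) = (\<Sum>i\<in>A. X x m (f i))"
  by (induction A rule: infinite_finite_induct) (auto simp: X_zero X_add)

lemma X_sum_left: "X (sum f A) m v = (\<Sum>i\<in>A. X (f i) m v)"
  by (induction A rule: infinite_finite_induct) (auto simp: X_zero_left X_add_left)

lemma Y_zero_left: "Y 0 m v = 0"
  using Y_scale_left[of 0 0 m v] by simp

lemma Y_zero_right: "Y u m 0 = 0"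
  using Y_scale_right[of u m 0 0] by simp

lemma X_vac: "m \<ge> 0 \<Longrightarrow> X x m vac = 0"
  using creation_nonneg[of m "X x (-1) vac"] by (simp add: X_Y)

lemma X_truncation: "\<exists>N. \<forall>m\<ge>N. X x m v = 0"
  using truncation[of "X x (-1) vac" v] by (simp add: X_Y)

lemma X_commute_twist:
  assumes "charge c x"
  shows "X x m (X y l v) = X (parity_twist (odd c) y) l (X x m v) + X (sl_bracket x y) (m + l) v
        + scale (if m + l = 0 then of_int m * sl_form x y * of_nat k else 0) v"
proof -
  have *: "X x m (X y l v) = X (parity_twist (odd c) y) l (X x m v) + X (sl_bracket x y) (m + l) v
        + scale (if m + l = 0 then of_int m * sl_form x y * of_nat k else 0) v" if "charge e y" for e y
    using X_commute[OF assms that, of m l v] by (simp add: parity_twist_charge[OF that] X_scale_left)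
  show ?thesis
    by (rule charge_decomposition[of y])
      (simp add: parity_twist_add X_add X_add_left * sl_bracket_add_right sl_form_add_right
        algebra_simps scale_left_distrib)
qed

text \<open>The operator product of two currents. No parity sign appears because it would multiply a mode that
  annihilates the vacuum, so the formula extends linearly from homogeneous elements.\<close>

lemma X_current:
  assumes "m \<ge> 0"
  shows "X x m (X y (-1) vac) = X (sl_bracket x y) (m - 1) vac + scale (if m = 1 then sl_form x y * of_nat k else 0) vac"
proof -
  have *: "X x m (X y (-1) vac) = X (sl_bracket x y) (m - 1) vac
      + scale (if m = 1 then sl_form x y * of_nat k else 0) vac" if "charge e x" for e x
    by (subst X_commute_twist[OF that]) (simp add: X_vac assms X_zero)
  show ?thesis
    by (rule charge_decomposition[of x])
      (simp add: X_add_left * sl_bracket_add_left sl_form_add_left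
        algebra_simps scale_left_distrib)
qed

text \<open>Borcherds' commutator formula: the Borcherds identity with $l = 0$.\<close>

lemma commutator:
  assumes "u \<in> V p" "v \<in> V q"
  shows "Sum_any (\<lambda>i::nat. scale (of_int m gchoose i) (Y (Y u (int i) v) (m + r - int i) w))
    = Y u m (Y v r w) - scale (super_sign p q) (Y v r (Y u m w))"
proof -
  have "Sum_any (\<lambda>i::nat. scale (of_int m gchoose i) (Y (Y u (0 + int i) v) (m + r - int i) w)) =
      Sum_any (\<lambda>i::nat. scale ((-1) ^ i * (of_int 0 gchoose i))
        (Y u (m + 0 - int i) (Y v (r + int i) w)
         - scale ((-1) powi 0 * super_sign p q) (Y v (r + 0 - int i) (Y u (m + int i) w))))"
    by (rule jacobi[OF assms])
  also have "\<dots> = Y u m (Y v r w) - scale (super_sign p q) (Y v r (Y u m w))"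
    by (subst Sum_any_eq_single[of 0]) (auto simp: gr0_conv_Suc)
  finally show ?thesis by simp
qed

text \<open>At the critical level division by zero gives $\omega = 0$. Then $L(-1) = 0$, and the translation
  property kills every mode $x(m)$ with $m \ne -1$, in contradiction to
  $J(1)J(-1)\mathbf 1 = k(J|J)\mathbf 1 \ne 0$.\<close>

lemma level_shift_nonzero: "of_nat k + h \<noteq> 0"
proof
  assume "of_nat k + h = 0"
  then have "\<omega> = 0" by (simp add: omega)
  then have "scale (- of_int m) (Y u (m - 1) v) = 0" for u m v
    using translation[of u m v] by (simp add: Y_zero_left)
  from this[of 2 "X central_elt (-1) vac" "X central_elt (-1) vac"]
  have "X central_elt 1 (X central_elt (-1) vac) = 0" by (simp add: X_Y)
  moreover have "X central_elt 1 (X central_elt (-1) vac) = scale (sl_form central_elt (central_elt :: 'n sl1) * of_nat k) vac"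
    by (simp add: X_current X_vac)
  ultimately show False using vac_nonzero level_pos card by (simp add: central_elt_norm)
qed

lemma X_omega:
  assumes "charge c x" "m \<ge> 0"
  shows "X x m \<omega> = scale (1 / (2 * (of_nat k + h))) (\<Sum>i<d.
      X (parity_twist (odd c) (a i)) (-1) (X x m (X (b i) (-1) vac)) + X (sl_bracket x (a i)) (m - 1) (X (b i) (-1) vac)
        + scale (if m = 1 then sl_form x (a i) * of_nat k else 0) (X (b i) (-1) vac))"
  unfolding omega X_scale X_sum
  by (subst X_commute_twist[OF assms(1)]) (simp add: if_distrib cong: if_cong)

text \<open>Commuting $x(1)$ through $\omega$ leaves a double bracket, which is $2hx$ by the
  definition of the Coxeter number, and two contractions, each equal to $kx$ by duality. The sum $2(k+h)x$
  cancels the normalisation of $\omega$.\<close>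

lemma X_omega_1:
  assumes "charge c x"
  shows "X x 1 \<omega> = X x (-1) vac"
proof -
  let ?s = "if odd c then -1 else 1 :: complex"
  have 1: "(\<Sum>i<d. sl_scale (sl_form x (b i)) (parity_twist (odd c) (a i))) = x"
  proof -
    have "(\<Sum>i<d. sl_scale (sl_form x (b i)) (parity_twist (odd c) (a i)))
       = sl_scale ?s (parity_twist (odd c) (\<Sum>i<d. sl_scale (sl_form (b i) x) (a i)))"
      by (subst sl_form_swap[OF assms])
        (simp add: parity_twist_sum parity_twist_scale sl.scale_sum_right)
    also have "\<dots> = sl_scale ?s (parity_twist (odd c) x)"
      using dual_bases_expand(1)[OF bases, of x] by simp
    also have "\<dots> = x" by (simp add: parity_twist_charge[OF assms] super_sign_def)
    finally show ?thesis .
  qed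
  have "X x 1 \<omega> = scale (1 / (2 * (of_nat k + h))) (\<Sum>i<d.
      scale (of_nat k) (X (sl_scale (sl_form x (b i)) (parity_twist (odd c) (a i))) (-1) vac)
      + X (sl_bracket (sl_bracket x (a i)) (b i)) (-1) vac
      + scale (of_nat k) (X (sl_scale (sl_form x (a i)) (b i)) (-1) vac))"
    unfolding X_omega[OF assms, of 1, simplified]
    by (simp add: X_current X_vac X_scale X_scale_left mult.commute)
  also have "\<dots> = scale (1 / (2 * (of_nat k + h))) (scale (of_nat k) (X x (-1) vac)
      + X (sl_scale (2 * h) x) (-1) vac + scale (of_nat k) (X x (-1) vac))"
    by (simp add: sum.distrib flip: scale_sum_right X_sum_left)
      (simp add: 1 casimir_right[OF bases coxeter] flip: dual_bases_expand(2)[OF bases])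
  also have "\<dots> = scale (1 / (2 * (of_nat k + h)) * (2 * (of_nat k + h))) (X x (-1) vac)"
    by (simp add: X_scale_left algebra_simps flip: scale_left_distrib)
  also have "1 / (2 * (of_nat k + h)) * (2 * (of_nat k + h)) = 1"
  proof -
    have "1 / z * z = 1" if "z \<noteq> 0" for z :: complex using that by simp
    from this[of "2 * (of_nat k + h)"] show ?thesis
      using level_shift_nonzero by (metis mult_eq_0_iff zero_neq_numeral)
  qed
  finally show ?thesis by simp
qed

text \<open>Only multiples of the vacuum can occur, by weight; their values do not affect $L(0)$.\<close>

lemma X_omega_higher:
  assumes "charge c x" "m \<ge> 2"
  shows "\<exists>\<alpha>. X x m \<omega> = scale \<alpha> vac"
proof -
  have "X x m \<omega> = scale (1 / (2 * (of_nat k + h))) (\<Sum>i<d.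
        scale (if m = 2 then sl_form (sl_bracket x (a i)) (b i) * of_nat k else 0) vac)"
    unfolding X_omega[OF assms(1) order_trans[OF _ assms(2)], simplified]
    using assms by (simp add: X_current X_vac X_zero)
  then show ?thesis by (simp flip: scale_sum_left)
qed

definition L0 :: "'v \<Rightarrow> 'v" where "L0 v = Y \<omega> 1 v"

lemma L0_add: "L0 (v + w) = L0 v + L0 w"
  by (simp add: L0_def Y_add_right)

lemma L0_scale: "L0 (scale \<alpha> v) = scale \<alpha> (L0 v)"
  by (simp add: L0_def Y_scale_right)

lemma L0_vac: "L0 vac = 0"
  by (simp add: L0_def creation_nonneg)

text \<open>Skew-symmetry, through the commutator of $x(-1)$ and $L(0)$ on the vacuum: of the products
  $x(i)\omega$ only the one with $i = 1$ contributes, because for other $i$ they are killed by the vacuum axioms.\<close>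

lemma L0_current:
  assumes "charge c x"
  shows "L0 (X x (-1) vac) = X x (-1) vac"
proof -
  let ?f = "\<lambda>i::nat. scale (of_int (-1) gchoose i) (Y (Y (X x (-1) vac) (int i) \<omega>) (-1 + 1 - int i) vac)"
  have "Sum_any ?f = - L0 (X x (-1) vac)"
    by (subst commutator[OF X_parity[OF assms] omega_even])
      (simp add: X_Y super_sign_def L0_def creation_nonneg Y_zero_right X_zero)
  moreover have "?f i = 0" if "i \<noteq> 1" for i
  proof (cases "i \<ge> 2")
    case True
    then obtain \<alpha> where "X x (int i) \<omega> = scale \<alpha> vac" using X_omega_higher[OF assms, of "int i"] by auto
    then show ?thesis using True by (simp add: X_Y Y_scale_left vacuum)
  next
    case False
    then show ?thesis using that by (simp add: creation_nonneg)
  qed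
  then have "Sum_any ?f = ?f 1" by (rule Sum_any_eq_single)
  ultimately show ?thesis using X_omega_1[OF assms] by (simp add: X_Y creation)
qed

text \<open>The commutator formula for $\omega$ and a current has two terms; the first is given by the translation
  property, the second by the weight of the current.\<close>

lemma L0_commute_charge:
  assumes "charge c x"
  shows "L0 (X x m v) = X x m (L0 v) - scale (of_int m) (X x m v)"
proof -
  let ?f = "\<lambda>i::nat. scale (of_int 1 gchoose i) (Y (Y \<omega> (int i) (X x (-1) vac)) (1 + m - int i) v)"
  have "Sum_any ?f = L0 (X x m v) - X x m (L0 v)"
    by (subst commutator[OF omega_even X_parity[OF assms]]) (simp add: X_Y super_sign_def L0_def)
  moreover have "Sum_any ?f = sum ?f {..1}"
  proof (rule Sum_any_eq_atMost)
    fix i :: nat assume "i > 1"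
    then have "1 gchoose i = (0 :: complex)" using binomial_gbinomial[of 1 i, where 'a = complex] by (simp add: binomial_eq_0)
    then show "?f i = 0" by simp
  qed
  moreover have "sum ?f {..1} = scale (- of_int (1 + m)) (X x m v) + X x m v"
    using translation[of "X x (-1) vac" "1 + m" v] L0_current[OF assms] by (simp add: X_Y L0_def)
  moreover have "scale (- of_int (1 + m)) (X x m v) + X x m v = - scale (of_int m) (X x m v)"
    by (simp add: scale_left_distrib scale_left_diff_distrib)
  ultimately show ?thesis by (simp add: diff_eq_eq)
qed

lemma L0_commute: "L0 (X x m v) = X x m (L0 v) - scale (of_int m) (X x m v)"
  by (rule charge_decomposition[of x])
    (simp add: X_add_left L0_add L0_commute_charge scale_right_distrib)

section \<open>Words in the negative modes\<close>

abbreviation J :: "int \<Rightarrow> 'v \<Rightarrow> 'v" where "J \<equiv> X central_elt"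

lemma J_commute:
  assumes "charge c x"
  shows "J m (X x l v) = X x l (J m v) + scale (of_int c) (X x (m + l) v)
     + scale (if m + l = 0 then of_int m * sl_form central_elt x * of_nat k else 0) v"
  using X_commute[OF central_elt_charge assms, of m l v]
  by (simp add: super_sign_def central_elt_bracket[OF card assms] X_scale_left)

text \<open>Monomials in negative modes of homogeneous elements, applied to the vacuum. Conformal weight, charge and
  parity of a monomial can be read off, and inductions over $V$ run over monomials.\<close>

inductive word :: "nat \<Rightarrow> int \<Rightarrow> 'v \<Rightarrow> bool" where
  word_vac: "word 0 0 vac"
| word_step: "charge c x \<Longrightarrow> word N e v \<Longrightarrow> word (N + Suc q) (c + e) (X x (-1 - int q) v)"

text \<open>The reordering part of the Poincare--Birkhoff--Witt theorem: commuting a nonnegative mode to the right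
  through a word ends at the vacuum, and each commutator is a shorter word preceded by a single mode.\<close>

lemma span_words: "span {v. \<exists>N e. word N e v} = UNIV" (is "span ?S = _")
proof (rule generated)
  show "subspace (span ?S)" by (rule subspace_span)
  show "vac \<in> span ?S" by (rule span_base) (use word_vac in blast)
  have neg: "X x m v \<in> span ?S" if "charge c x" "m < 0" "v \<in> span ?S" for c x m v
  proof (rule span_image_subspace[of "X x m", OF X_add X_scale _ subspace_span that(3)])
    fix v assume "v \<in> ?S"
    then obtain N e where "word N e v" by blast
    from word_step[OF that(1) this, of "nat (-1 - m)"] that(2) show "X x m v \<in> span ?S"
      by (intro span_base) auto
  qed
  have nonneg: "word N e v \<Longrightarrow> charge c x \<Longrightarrow> m \<ge> 0 \<Longrightarrow> X x m v \<in> span ?S" for N e v c x m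
  proof (induction arbitrary: c x m rule: word.induct)
    case word_vac
    then show ?case by (simp add: X_vac span_zero)
  next
    case (word_step c' y N e v q)
    have v: "v \<in> span ?S" using word_step by (intro span_base) blast
    have "X (sl_bracket x y) (m + (-1 - int q)) v \<in> span ?S"
      using word_step.IH neg[OF _ _ v] charge_bracket[OF word_step.prems(1) word_step.hyps(1)]
      by (cases "m + (-1 - int q) \<ge> 0") auto
    moreover have "X y (-1 - int q) (X x m v) \<in> span ?S"
      by (rule neg[OF word_step.hyps(1) _ word_step.IH[OF word_step.prems]]) simp
    ultimately show ?case
      unfolding X_commute[OF word_step.prems(1) word_step.hyps(1)] by (intro span_add span_scale v)
  qed
  show "X x m v \<in> span ?S" if "charge c x" "v \<in> span ?S" for c x m v
  proof (cases "m < 0")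
    case False
    show ?thesis
      by (rule span_image_subspace[of "X x m", OF X_add X_scale _ subspace_span that(2)])
        (use nonneg that False in auto)
  qed (use neg that in blast)
qed

lemma word_L0: "word N e v \<Longrightarrow> L0 v = scale (of_nat N) v"
proof (induction rule: word.induct)
  case word_vac
  then show ?case by (simp add: L0_vac)
next
  case (word_step c x N e v q)
  then show ?case
    by (simp add: L0_commute X_scale algebra_simps flip: scale_left_distrib scale_left_diff_distrib)
qed

lemma word_J: "word N e v \<Longrightarrow> J 0 v = scale (of_int e) v"
proof (induction rule: word.induct)
  case word_vac
  then show ?case by (simp add: X_vac)
next
  case (word_step c x N e v q)
  then show ?case
    by (simp add: J_commute[OF word_step(1)] X_scale algebra_simps flip: scale_left_distrib)
qed

lemma word_parity: "word N e v \<Longrightarrow> v \<in> V (odd e)"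
proof (induction rule: word.induct)
  case word_vac
  then show ?case by (simp add: vac_even)
next
  case (word_step c x N e v q)
  have "X x (-1 - int q) v \<in> V (odd c \<noteq> odd e)"
    using Y_parity[OF X_parity[OF word_step(1)] word_step(3), of "-1 - int q"] by (simp add: X_Y)
  moreover have "(odd c \<noteq> odd e) = odd (c + e)" by simp
  ultimately show ?case by (simp only:)
qed

section \<open>From $C_2$-cofiniteness to a relation among powers of the Heisenberg field\<close>

text \<open>The Borcherds identity with $m = 0$, which expresses modes of $u_l v$ through those of $u$ and $v$.\<close>

lemma associativity:
  assumes "u \<in> V p" "v \<in> V q"
  shows "Y (Y u l v) r w = Sum_any (\<lambda>i::nat. scale ((-1) ^ i * (of_int l gchoose i))
      (Y u (l - int i) (Y v (r + int i) w)
         - scale ((-1) powi l * super_sign p q) (Y v (r + l - int i) (Y u (int i) w))))"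
proof -
  have "Y (Y u l v) r w = Sum_any (\<lambda>i::nat. scale (of_int 0 gchoose i) (Y (Y u (l + int i) v) (0 + r - int i) w))"
    by (subst Sum_any_eq_single[of 0]) (auto simp: gr0_conv_Suc)
  also have "\<dots> = Sum_any (\<lambda>i::nat. scale ((-1) ^ i * (of_int l gchoose i))
      (Y u (0 + l - int i) (Y v (r + int i) w)
         - scale ((-1) powi l * super_sign p q) (Y v (r + l - int i) (Y u (0 + int i) w))))"
    by (rule jacobi[OF assms])
  finally show ?thesis by simp
qed

definition deep_span :: "'v set" where
  "deep_span = span {X x (-2 - int q) v | c x q N e v. charge c x \<and> word N e v}"

lemma subspace_deep_span: "subspace deep_span"
  by (simp add: deep_span_def)

lemma deep_spanI:
  assumes "charge c x" shows "X x (-2 - int q) v \<in> deep_span"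
proof (rule span_image_subspace[of "X x (-2 - int q)", OF X_add X_scale _ subspace_deep_span])
  show "v \<in> span {v. \<exists>N e. word N e v}" by (simp add: span_words)
  show "X x (-2 - int q) v \<in> deep_span" if "v \<in> {v. \<exists>N e. word N e v}" for v
    unfolding deep_span_def by (rule span_base) (use assms that in blast)
qed

text \<open>The commutator of $x(-1)$ and $y(-2-q)$ is $[x,y](-3-q)$ without a central term.\<close>

lemma deep_span_stable:
  assumes "charge c x" "v \<in> deep_span" shows "X x (-1) v \<in> deep_span"
  using assms(2) unfolding deep_span_def
proof (rule span_image_subspace[of "X x (-1)", OF X_add X_scale _ subspace_span, rotated])
  fix v assume "v \<in> {X x (-2 - int q) v | c x q N e v. charge c x \<and> word N e v}"
  then obtain e y q u where y: "charge e y" "v = X y (-2 - int q) u" by blast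
  have eq: "-1 + (-2 - int q) = -2 - int (Suc q)" and ne: "-2 - int (Suc q) \<noteq> 0" by auto
  show "X x (-1) v \<in> span {X x (-2 - int q) v | c x q N e v. charge c x \<and> word N e v}"
    unfolding deep_span_def[symmetric] y(2) X_commute[OF assms(1) y(1)] eq if_not_P[OF ne] scale_zero_left add_0_right
    by (intro subspace_add subspace_deep_span subspace_scale deep_spanI[OF y(1)] deep_spanI[OF charge_bracket[OF assms(1) y(1)]])
qed

text \<open>For a word $u = x(-1-q)u'$ associativity writes $u_{-2-l}$ through products of modes of $x$ and
  $u'$. Either the mode of $u'$ is at most $-2$, or that of $x$ is, or the term is $x(-1)u'_{-2-l}$.\<close>

lemma word_mode_deep_span: "word N e u \<Longrightarrow> Y u (-2 - int l) v \<in> deep_span"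
proof (induction arbitrary: l v rule: word.induct)
  case word_vac
  then show ?case using subspace_0[OF subspace_deep_span] by (simp add: vacuum)
next
  case (word_step c x N e u q)
  have 1: "X x (-1 - int q - int i) (Y u (-2 - int l + int i) v) \<in> deep_span" for i
  proof (cases "q + i = 0")
    case True
    then show ?thesis using deep_span_stable[OF word_step(1) word_step.IH[of l v]] by simp
  next
    case False
    then obtain p where "q + i = Suc p" by (cases "q + i") auto
    then have eq: "-1 - int q - int i = -2 - int p" by linarith
    show ?thesis unfolding eq by (rule deep_spanI[OF word_step(1)])
  qed
  have 2: "Y u (-2 - int l + (-1 - int q) - int i) w \<in> deep_span" for i w
  proof -
    have eq: "-2 - int l + (-1 - int q) - int i = -2 - int (l + Suc q + i)" by simp
    show ?thesis unfolding eq by (rule word_step.IH)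
  qed
  show ?case
    unfolding associativity[OF X_parity[OF word_step(1)] word_parity[OF word_step(2)], of "-1 - int q" _ v, unfolded X_Y]
    by (intro subspace_Sum_any subspace_deep_span subspace_scale subspace_diff 1 2)
qed

lemma C2_subset_deep_span: "C2 \<subseteq> deep_span"
  unfolding C2_def
proof (rule span_minimal[OF _ subspace_deep_span], safe)
  fix u v
  have "u \<in> span {v. \<exists>N e. word N e v}" by (simp add: span_words)
  then show "Y u (-2) v \<in> deep_span"
    by (rule span_image_subspace[of "\<lambda>u. Y u (-2) v", OF Y_add_left Y_scale_left _ subspace_deep_span, rotated])
      (use word_mode_deep_span[of _ _ _ 0] in auto)
qed

definition weights_upto :: "nat \<Rightarrow> 'v set" where
  "weights_upto N = span {v. \<exists>M\<le>N. L0 v = scale (of_nat M) v}"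

lemma weights_upto_mono: "M \<le> N \<Longrightarrow> weights_upto M \<subseteq> weights_upto N"
  unfolding weights_upto_def by (rule span_mono) (auto intro: order_trans)

lemma weights_upto_exhaust: "\<exists>N. v \<in> weights_upto N"
proof -
  have "v \<in> span {v. \<exists>N e. word N e v}" by (simp add: span_words)
  then show ?thesis
  proof (induction rule: span_induct_alt)
    case base
    then show ?case by (auto simp: weights_upto_def span_zero)
  next
    case (step c x y)
    then obtain N M e where *: "y \<in> weights_upto N" "word M e x" by blast
    then have "x \<in> weights_upto M" unfolding weights_upto_def by (intro span_base) (auto dest: word_L0)
    then have "x \<in> weights_upto (max M N)" "y \<in> weights_upto (max M N)"
      using * weights_upto_mono[of M "max M N"] weights_upto_mono[of N "max M N"] by auto
    then have "scale c x + y \<in> weights_upto (max M N)"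
      unfolding weights_upto_def by (intro span_add span_scale)
    then show ?case by blast
  qed
qed

lemma weights_upto_finite: "\<exists>B. finite B \<and> weights_upto N \<subseteq> span B"
proof -
  have "\<exists>B. finite B \<and> {v. L0 v = scale (of_nat M) v} \<subseteq> span B" for M
    using grading_finite[of "2 * int M"] by (simp add: L0_def)
  then obtain B where B: "\<And>M. finite (B M)" "\<And>M. {v. L0 v = scale (of_nat M) v} \<subseteq> span (B M)" by metis
  have "span (B M) \<subseteq> span (\<Union>M\<le>N. B M)" if "M \<le> N" for M
    by (rule span_mono) (use that in auto)
  then have "{v. \<exists>M\<le>N. L0 v = scale (of_nat M) v} \<subseteq> span (\<Union>M\<le>N. B M)"
    using B(2) by blast
  then have "weights_upto N \<subseteq> span (\<Union>M\<le>N. B M)"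
    unfolding weights_upto_def by (rule span_minimal) simp
  then show ?thesis using B(1) by blast
qed

lemma span_L0: "span {v. \<exists>\<mu>. L0 v = scale \<mu> v} = UNIV"
proof -
  have "span {v. \<exists>N e. word N e v} \<subseteq> span {v. \<exists>\<mu>. L0 v = scale \<mu> v}"
    by (rule span_mono) (auto dest: word_L0)
  then show ?thesis using span_words by auto
qed

text \<open>These are the vectors $\mathrm{Res}_z\, z^{-2-q}(1+z) Y(x(-1)\mathbf 1, z)u$ of Zhu's subspace $O(V)$. Up to
  lower weight they are the spanning vectors of $C_2(V)$.\<close>

definition zhu_relations :: "'v set" where
  "zhu_relations = {X x (-2 - int q) v + X x (-1 - int q) v | c x q N e v. charge c x \<and> word N e v}"

text \<open>Above the weights of representatives of $V/C_2(V)$ every homogeneous vector is a combination of vectors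
  $x(-2-q)u$ of the same weight. Modulo Zhu's relations each of them is $-x(-1-q)u$, of
  weight one less. So the weight spaces up to some weight, which are finite-dimensional, represent all of the
  quotient.\<close>

lemma cofinite_mod_zhu_relations:
  assumes C2_cofinite
  obtains B where "finite B" "\<And>v. \<exists>b\<in>span B. v - b \<in> span zhu_relations"
proof -
  obtain B where B: "finite B" "\<And>v. \<exists>b\<in>span B. v - b \<in> C2"
    using assms by (auto simp: C2_cofinite_def)
  have "\<exists>N. B \<subseteq> weights_upto N"
    using B(1)
  proof (induction B rule: finite_induct)
    case (insert x B)
    then obtain M N where "x \<in> weights_upto M" "B \<subseteq> weights_upto N" using weights_upto_exhaust by blast
    then have "insert x B \<subseteq> weights_upto (max M N)"
      using weights_upto_mono[of M "max M N"] weights_upto_mono[of N "max M N"] by auto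
    then show ?case by blast
  qed simp
  then obtain N1 where "B \<subseteq> weights_upto N1" by blast
  then have B_low: "span B \<subseteq> weights_upto N1" unfolding weights_upto_def by (rule span_minimal) simp
  have top: "v \<in> span {X x (-2 - int q) u | c x q M e u. charge c x \<and> word M e u \<and> N = M + q + 2}" (is "v \<in> span (?T N)")
    if v: "L0 v = scale (of_nat N) v" "N > N1" for v N
  proof -
    \<comment> \<open>The projection onto the weight space of \<open>v\<close> removes the representative.\<close>
    obtain F where F: "\<And>v w. F (v + w) = F v + F w" "\<And>c v. F (scale c v) = scale c (F v)"
      "\<And>\<mu> v. L0 v = scale \<mu> v \<Longrightarrow> F v = (if \<mu> = of_nat N then v else 0)"
      by (rule eigenspace_linear_extension[of L0 "\<lambda>\<mu> v. if \<mu> = of_nat N then v else 0", OF L0_add L0_scale span_L0]) auto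
    obtain b where b: "b \<in> span B" "v - b \<in> C2" using B(2) by blast
    have "F b \<in> {0}"
    proof (rule span_image_subspace[OF F(1,2) _ subspace_single_0])
      show "b \<in> span {v. \<exists>M\<le>N1. L0 v = scale (of_nat M) v}" using b(1) B_low by (auto simp: weights_upto_def)
    qed (use F(3) v(2) in force)
    moreover have "F (v - b) \<in> span (?T N)"
    proof (rule span_image_subspace[OF F(1,2) _ subspace_span])
      show "v - b \<in> span {X x (-2 - int q) v | c x q N e v. charge c x \<and> word N e v}"
        using b(2) C2_subset_deep_span by (auto simp: deep_span_def)
      fix y assume "y \<in> {X x (-2 - int q) v | c x q N e v. charge c x \<and> word N e v}"
      then obtain c x q M e u where y: "charge c x" "word M e u" "y = X x (-2 - int q) u" by blast
      have "word (M + Suc (Suc q)) (c + e) y"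
        using word_step[OF y(1,2), of "Suc q"] by (simp add: y(3))
      from F(3)[OF word_L0[OF this]] have "F y = (if M + q + 2 = N then y else 0)"
        by (simp flip: of_nat_eq_iff[where 'a = complex] del: of_nat_eq_iff)
      moreover have "y \<in> span (?T N)" if "M + q + 2 = N"
        by (rule span_base) (use y that in blast)
      ultimately show "F y \<in> span (?T N)" by (simp add: span_zero)
    qed
    moreover have "F v = F (v - b) + F b" using F(1)[of "v - b" b] by simp
    ultimately show ?thesis using F(3)[OF v(1)] by simp
  qed
  have eig: "L0 v = scale (of_nat N) v \<Longrightarrow> v \<in> span (weights_upto N1 \<union> zhu_relations)" for v N
  proof (induction N arbitrary: v rule: less_induct)
    case (less N)
    show ?case
    proof (cases "N \<le> N1")
      case True
      then have "v \<in> weights_upto N1" using less.prems unfolding weights_upto_def by (intro span_base) blast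
      then show ?thesis by (intro span_base) blast
    next
      case False
      have "?T N \<subseteq> span (weights_upto N1 \<union> zhu_relations)"
      proof
        fix y assume "y \<in> ?T N"
        then obtain c x q M e u where y: "charge c x" "word M e u" "y = X x (-2 - int q) u" "N = M + q + 2" by blast
        have "L0 (X x (-1 - int q) u) = scale (of_nat (M + Suc q)) (X x (-1 - int q) u)"
          by (rule word_L0[OF word_step[OF y(1,2)]])
        then have 1: "X x (-1 - int q) u \<in> span (weights_upto N1 \<union> zhu_relations)"
          by (rule less.IH[rotated]) (simp add: y)
        have "X x (-2 - int q) u + X x (-1 - int q) u \<in> span (weights_upto N1 \<union> zhu_relations)"
          by (rule span_base) (use y in \<open>auto simp: zhu_relations_def\<close>)
        from span_diff[OF this 1] show "y \<in> span (weights_upto N1 \<union> zhu_relations)" by (simp add: y)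
      qed
      then have "span (?T N) \<subseteq> span (weights_upto N1 \<union> zhu_relations)"
        by (rule span_minimal) (rule subspace_span)
      moreover have "v \<in> span (?T N)"
        by (rule top[OF less.prems]) (use False in simp)
      ultimately show ?thesis by (rule subsetD)
    qed
  qed
  obtain B' where B': "finite B'" "weights_upto N1 \<subseteq> span B'" using weights_upto_finite by blast
  show thesis
  proof
    show "finite B'" by fact
    fix v
    have "v \<in> span {v. \<exists>N e. word N e v}" by (simp add: span_words)
    also have "span {v. \<exists>N e. word N e v} \<subseteq> span (weights_upto N1 \<union> zhu_relations)"
      by (rule span_minimal) (auto intro: eig dest: word_L0)
    finally obtain x y where "v = x + y" "x \<in> span (weights_upto N1)" "y \<in> span zhu_relations"
      by (auto simp: span_Un)
    moreover have "span (weights_upto N1) \<subseteq> span B'" using B'(2) by (rule span_minimal) simp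
    ultimately show "\<exists>b\<in>span B'. v - b \<in> span zhu_relations" by (intro bexI[of _ x]) auto
  qed
qed

lemma heisenberg_word: "word i 0 ((J (-1) ^^ i) vac)"
proof (induction i)
  case (Suc i)
  from word_step[OF central_elt_charge this, of 0] show ?case by simp
qed (simp add: word_vac)

text \<open>Infinitely many vectors $J(-1)^i \mathbf 1$ in a finite-dimensional quotient.\<close>

lemma cofinite_relation:
  assumes C2_cofinite
  obtains c n where "(\<Sum>i\<le>n. scale (c i) ((J (-1) ^^ i) vac)) \<in> span zhu_relations" "\<exists>i\<le>n. c i \<noteq> 0"
proof -
  obtain B where B: "finite B" "\<And>v. \<exists>b\<in>span B. v - b \<in> span zhu_relations"
    using cofinite_mod_zhu_relations[OF assms] by blast
  from B(2) obtain b where b: "\<And>v. b v \<in> span B" "\<And>v. v - b v \<in> span zhu_relations" by metis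
  obtain c n where c: "(\<Sum>i\<le>n. scale (c i) (b ((J (-1) ^^ i) vac))) = 0" "\<exists>i\<le>n. c i \<noteq> 0"
    using linear_relation[OF B(1), of "\<lambda>i. b ((J (-1) ^^ i) vac)"] b(1) by metis
  have "(\<Sum>i\<le>n. scale (c i) ((J (-1) ^^ i) vac - b ((J (-1) ^^ i) vac))) \<in> span zhu_relations"
    by (intro span_sum span_scale b)
  then show thesis using c by (intro that[of c n]) (auto simp: scale_right_diff_distrib sum_subtractf)
qed

section \<open>Top vectors of the spectral flows\<close>

definition bihom :: "int \<Rightarrow> int \<Rightarrow> 'v \<Rightarrow> bool" where
  "bihom N r v \<longleftrightarrow> L0 v = scale (of_int N) v \<and> J 0 v = scale (of_int r) v"

lemma bihom_X: "charge c x \<Longrightarrow> bihom N r v \<Longrightarrow> bihom (N - m) (r + c) (X x m v)"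
  by (auto simp: bihom_def L0_commute J_commute X_scale algebra_simps scale_left_distrib scale_left_diff_distrib)

lemma weights_bounded: "\<exists>N0. \<forall>N r v. bihom N r v \<longrightarrow> v \<noteq> 0 \<longrightarrow> N \<ge> N0"
proof -
  obtain N' :: int where N': "\<And>j. j < N' \<Longrightarrow> {v. Y \<omega> 1 v = scale (of_int j / 2) v} = {0}"
    using grading_bounded by blast
  have "N \<ge> - \<bar>N'\<bar>" if "bihom N r v" "v \<noteq> 0" for N r v
  proof (rule ccontr)
    assume "\<not> ?thesis"
    then have "2 * N < N'" by linarith
    from N'[OF this] that show False by (auto simp: bihom_def L0_def)
  qed
  then show ?thesis by blast
qed

lemma odd_anticommute:
  assumes "charge c x" "charge c y" "odd c"
  shows "X x m (X y l v) = - X y l (X x m v)"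
proof -
  have "c \<noteq> 0" using assms(3) by auto
  then show ?thesis
    using X_commute[OF assms(1,2), of m l v] assms(3) sl_bracket_same_charge[OF assms(1,2)] sl_form_charge[OF assms(1,2)]
    by (simp add: super_sign_def X_zero_left)
qed

text \<open>The vacuum is annihilated by $x(j)$ with $j \ge 0$. There remain the finitely many pairs of a basis
  vector $x$ of $\mathfrak g_{-1}$ and $1 - s \le j < 0$. Their operators anticommute and have square zero: if such an
  operator does not annihilate the vector found so far, its image is annihilated by it and by all the previous
  ones. An application changes $N + sr$ by $-(j+s) < 0$.\<close>

lemma killed_by_negative_charge:
  fixes s :: nat
  obtains v N r where "v \<noteq> 0" "bihom N r v" "N + int s * r \<le> 0"
    "\<And>x j. charge (-1) x \<Longrightarrow> j \<ge> 1 - int s \<Longrightarrow> X x j v = 0"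
proof -
  define P where "P v \<longleftrightarrow> v \<noteq> 0 \<and> (\<exists>N r. bihom N r v \<and> N + int s * r \<le> 0)
    \<and> (\<forall>x j. charge (-1) x \<longrightarrow> j \<ge> 0 \<longrightarrow> X x j v = 0)" for v
  obtain S where S: "finite S" "\<And>x. x \<in> S \<Longrightarrow> charge (-1) x" "\<And>x :: 'n sl1. charge (-1) x \<Longrightarrow> x \<in> sl.span S"
    using finite_charge_spanning[OF bases, of "-1"] by metis
  have "\<exists>v. P v \<and> (\<forall>(x, j)\<in>A. X x j v = 0)"
    if "finite A" "\<And>x j. (x, j) \<in> A \<Longrightarrow> charge (-1) x \<and> j \<ge> 1 - int s" for A :: "('n sl1 \<times> int) set"
    using that
  proof (induction A rule: finite_induct)
    case empty
    have "P vac" unfolding P_def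
      using vac_nonzero L0_vac X_vac by (intro conjI exI[of _ 0]) (auto simp: bihom_def)
    then show ?case by auto
  next
    case (insert p A)
    obtain x j where p: "p = (x, j)" by (cases p)
    have x: "charge (-1) x" "j \<ge> 1 - int s" using insert.prems[of x j] by (auto simp: p)
    obtain v where v: "P v" "\<forall>(x, j)\<in>A. X x j v = 0" using insert by blast
    show ?case
    proof (cases "X x j v = 0")
      case True
      then show ?thesis using v by (auto simp: p)
    next
      case False
      have anti: "X y l (X x j v) = - X x j (X y l v)" if "charge (-1) y" for y l
        using odd_anticommute[OF that x(1)] by simp
      from v(1) obtain N r where N: "bihom N r v" "N + int s * r \<le> 0" unfolding P_def by blast
      have "bihom (N - j) (r + -1) (X x j v)" by (rule bihom_X[OF x(1) N(1)])
      moreover have "(N - j) + int s * (r + -1) \<le> 0" using N(2) x(2) by (simp add: algebra_simps)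
      ultimately have "P (X x j v)"
        using False v(1) anti unfolding P_def by (auto simp: X_zero)
      moreover have "X y l (X x j v) = 0" if "(y, l) \<in> A" for y l
        using anti[of y l] insert.prems[of y l] v(2) that by (auto simp: X_zero)
      moreover have "X x j (X x j v) = 0"
      proof -
        have "scale 2 (X x j (X x j v)) = X x j (X x j v) + X x j (X x j v)"
          using scale_left_distrib[of 1 1 "X x j (X x j v)"] by simp
        also have "\<dots> = 0" using anti[OF x(1), of j] by (metis add.right_inverse)
        finally show ?thesis by simp
      qed
      ultimately show ?thesis by (intro exI[of _ "X x j v"]) (auto simp: p)
    qed
  qed
  from this[of "S \<times> {1 - int s..<0}"] S(1,2) obtain v
    where v: "P v" "\<And>x j. x \<in> S \<Longrightarrow> 1 - int s \<le> j \<Longrightarrow> j < 0 \<Longrightarrow> X x j v = 0" by fastforce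
  have "X x j v = 0" if x: "charge (-1) x" "j \<ge> 1 - int s" for x j
  proof (cases "j \<ge> 0")
    case True
    then show ?thesis using v(1) x by (simp add: P_def)
  next
    case False
    from S(3)[OF x(1)] show ?thesis
    proof (induction rule: sl.span_induct_alt)
      case (step c x y)
      then show ?case using v(2)[of x j] x False by (simp add: X_add_left X_scale_left)
    qed (simp add: X_zero_left)
  qed
  with v(1) that show thesis unfolding P_def by blast
qed

text \<open>Annihilated by all positive modes of the $s$-th spectral flow, in which an element of charge $c$ has its
  modes shifted by $sc$.\<close>

definition top_vector :: "nat \<Rightarrow> 'v \<Rightarrow> bool" where
  "top_vector s y \<longleftrightarrow> (\<forall>c x j. charge c x \<longrightarrow> j > 0 \<longrightarrow> X x (j + int s * c) y = 0)"

text \<open>Among the bihomogeneous vectors with $N + sr \le 0$ that are annihilated by the positive modes of charge $-1$,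
  one of least weight $N$ has the required property. Indeed positive modes of charge
  $0$ and, on vectors killed by those, of charge $1$ preserve these conditions, and they lower $N$.\<close>

lemma top_vector_exists:
  obtains w N r where "w \<noteq> 0" "bihom N r w" "N + int s * r \<le> 0" "top_vector s w"
proof -
  define Q where "Q v N r \<longleftrightarrow> v \<noteq> 0 \<and> bihom N r v \<and> N + int s * r \<le> 0 \<and>
    (\<forall>x j. charge (-1) x \<longrightarrow> j \<ge> 1 - int s \<longrightarrow> X x j v = 0)" for v N r
  obtain N0 where N0: "\<And>N r v. bihom N r v \<Longrightarrow> v \<noteq> 0 \<Longrightarrow> N \<ge> N0"
    using weights_bounded by blast
  \<comment> \<open>Weights are at least $N_0$, so the least one can be found among natural numbers.\<close>
  have "\<exists>m v r. Q v (N0 + int m) r"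
  proof -
    obtain v N r where "Q v N r" using killed_by_negative_charge[of s] unfolding Q_def by metis
    moreover then have "N = N0 + int (nat (N - N0))" using N0[of N r v] by (simp add: Q_def)
    ultimately show ?thesis by metis
  qed
  then obtain m where m: "\<exists>v r. Q v (N0 + int m) r" "\<And>m'. m' < m \<Longrightarrow> \<not> (\<exists>v r. Q v (N0 + int m') r)"
    using exists_least_iff[of "\<lambda>m. \<exists>v r. Q v (N0 + int m) r"] by auto
  from m(1) obtain w r where w: "Q w (N0 + int m) r" by blast
  define N where "N = N0 + int m"
  have least: "\<not> Q v M r'" if "M < N" for v M r'
  proof
    assume Q: "Q v M r'"
    then have "M \<ge> N0" using N0[of M r' v] by (simp add: Q_def)
    then have "Q v (N0 + int (nat (M - N0))) r'" using Q by simp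
    moreover have "nat (M - N0) < m" using that \<open>M \<ge> N0\<close> by (simp add: N_def)
    ultimately show False using m(2) by blast
  qed
  have wN: "w \<noteq> 0" "bihom N r w" "N + int s * r \<le> 0"
    and neg: "\<And>x j. charge (-1) x \<Longrightarrow> j \<ge> 1 - int s \<Longrightarrow> X x j w = 0"
    using w by (auto simp: Q_def N_def)
  have zero: "X x j w = 0" if x: "charge 0 x" "j > 0" for x j
  proof (rule ccontr)
    assume nz: "X x j w \<noteq> 0"
    have "Q (X x j w) (N - j) (r + 0)"
      unfolding Q_def
    proof (intro conjI nz bihom_X x wN allI impI)
      show "N - j + int s * (r + 0) \<le> 0" using wN(3) x by simp
      fix y :: "'n sl1" and l assume y: "charge (-1) y" "l \<ge> 1 - int s"
      have "X (sl_bracket y x) (l + j) w = 0"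
        using charge_bracket[OF y(1) x(1)] y(2) x(2) by (intro neg) auto
      then show "X y l (X x j w) = 0"
        using X_commute[OF y(1) x(1), of l j w] neg[OF y] sl_form_charge[OF y(1) x(1)] by (simp add: X_zero)
    qed
    then show False using least[of "N - j"] x by simp
  qed
  have pos: "X x j w = 0" if x: "charge 1 x" "j > int s" for x j
  proof (rule ccontr)
    assume nz: "X x j w \<noteq> 0"
    have "Q (X x j w) (N - j) (r + 1)"
      unfolding Q_def
    proof (intro conjI nz bihom_X x wN allI impI)
      show "N - j + int s * (r + 1) \<le> 0" using wN(3) x by (simp add: algebra_simps)
      fix y :: "'n sl1" and l assume y: "charge (-1) y" "l \<ge> 1 - int s"
      have "X (sl_bracket y x) (l + j) w = 0"
        using charge_bracket[OF y(1) x(1)] y(2) x(2) by (intro zero) auto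
      then show "X y l (X x j w) = 0"
        using X_commute[OF y(1) x(1), of l j w] neg[OF y] y(2) x(2) by (simp add: X_zero)
    qed
    then show False using least[of "N - j"] x by simp
  qed
  have "top_vector s w"
    unfolding top_vector_def
  proof (intro allI impI)
    fix c and x :: "'n sl1" and j :: int assume x: "charge c x" "j > 0"
    show "X x (j + int s * c) w = 0"
    proof (cases "x = 0")
      case False
      then consider "c = -1" | "c = 0" | "c = 1" using charge_cases[OF x(1)] by blast
      then show ?thesis by cases (use x neg zero pos in auto)
    qed (simp add: X_zero_left)
  qed
  with wN show thesis by (rule that)
qed

section \<open>Li's operator\<close>

text \<open>The coefficient of $z^{-i}$ in $\exp(\sum_{j \ge 1} (-1)^{j+1} \frac sj J(j) z^{-j})$, by the
  recursion that differentiation of the exponential gives.\<close>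

fun Delta :: "nat \<Rightarrow> nat \<Rightarrow> 'v \<Rightarrow> 'v" where
  "Delta s 0 u = u"
| "Delta s (Suc i) u = scale (of_nat s / of_nat (Suc i))
     (\<Sum>j\<le>i. scale ((-1) ^ j) (J (int (Suc j)) (Delta s (i - j) u)))"

lemma Delta_Suc:
  "scale (of_nat (Suc i)) (Delta s (Suc i) u)
     = scale (of_nat s) (\<Sum>j\<le>i. scale ((-1) ^ j) (J (int (Suc j)) (Delta s (i - j) u)))"
  by (simp del: of_nat_Suc)

declare Delta.simps(2) [simp del]

lemma Delta_add: "Delta s i (u + v) = Delta s i u + Delta s i v"
proof (induction i rule: less_induct)
  case (less i)
  show ?case
  proof (cases i)
    case (Suc n)
    then show ?thesis using less by (simp add: Delta.simps(2) X_add scale_right_distrib sum.distrib)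
  qed simp
qed

lemma Delta_scale: "Delta s i (scale \<alpha> u) = scale \<alpha> (Delta s i u)"
proof (induction i rule: less_induct)
  case (less i)
  show ?case
  proof (cases i)
    case (Suc n)
    then show ?thesis using less
      by (simp add: Delta.simps(2) X_scale scale_sum_right scale_left_commute mult.left_commute mult.commute)
  qed simp
qed

lemma Delta_vac: "i > 0 \<Longrightarrow> Delta s i vac = 0"
proof (induction i rule: less_induct)
  case (less i)
  then obtain n where n: "i = Suc n" by (cases i) auto
  have "J (int (Suc j)) (Delta s (n - j) vac) = 0" for j
    using less.IH[of "n - j"] by (cases "n - j = 0") (auto simp: n X_vac X_zero)
  then show ?case by (simp add: n Delta.simps(2))
qed

lemma Delta_parity: "u \<in> V p \<Longrightarrow> Delta s i u \<in> V p"
proof (induction i rule: less_induct)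
  case (less i)
  have J: "J m v \<in> V p" if "v \<in> V p" for m v
    using Y_parity[OF X_parity[OF central_elt_charge] that, of m] by (simp add: X_Y)
  show ?case
  proof (cases i)
    case (Suc n)
    then show ?thesis unfolding Suc Delta.simps(2)
      by (intro subspace_scale subspace_sum parity_subspace J less) (auto simp: Suc)
  qed (use less in simp)
qed

lemma bihom_subspace: "subspace {v. bihom N r v}"
  using L0_scale[of 0 0] by (auto simp: subspace_def bihom_def L0_add L0_scale X_add X_scale X_zero scale_right_distrib scale_left_commute)

lemma Delta_bihom: "bihom N r u \<Longrightarrow> bihom (N - int i) r (Delta s i u)"
proof (induction i rule: less_induct)
  case (less i)
  show ?case
  proof (cases i)
    case (Suc n)
    have "bihom (N - int i) r (J (int (Suc j)) (Delta s (n - j) u))" if "j \<le> n" for j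
      using bihom_X[OF central_elt_charge less.IH[of "n - j", OF _ less.prems], of "int (Suc j)"] that
      by (simp add: Suc of_nat_diff algebra_simps)
    then have "Delta s i u \<in> {v. bihom (N - int i) r v}"
      unfolding Suc Delta.simps(2) by (intro subspace_scale subspace_sum bihom_subspace) auto
    then show ?thesis by simp
  qed (use less in simp)
qed

lemma word_bihom: "word N e u \<Longrightarrow> bihom (int N) e u"
  by (simp add: bihom_def word_L0 word_J)

text \<open>The $i$-th coefficient lowers the weight by $i$, and weights are bounded below.\<close>

lemma Delta_finite: "\<exists>M. \<forall>i>M. Delta s i u = 0"
proof -
  obtain N0 where N0: "\<And>N r v. bihom N r v \<Longrightarrow> v \<noteq> 0 \<Longrightarrow> N \<ge> N0"
    using weights_bounded by blast
  have "u \<in> span {v. \<exists>N e. word N e v}" by (simp add: span_words)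
  then show ?thesis
  proof (induction rule: span_induct_alt)
    case base
    then show ?case using Delta_scale[of s _ 0 0] by simp
  next
    case (step c x y)
    then obtain M N e where M: "\<And>i. i > M \<Longrightarrow> Delta s i y = 0" and x: "word N e x" by blast
    have "Delta s i x = 0" if "i > nat (int N - N0)" for i
      using N0[OF Delta_bihom[OF word_bihom[OF x], of i s]] that by fastforce
    then show ?case using M
      by (intro exI[of _ "max M (nat (int N - N0))"]) (auto simp: Delta_add Delta_scale)
  qed
qed

text \<open>In terms of generating functions, $[J(j), x(m)] = c\,x(m+j)$ makes conjugation by $\Delta(z)$ act on modes of $x$ as
  $\exp(\sum_j (-1)^{j+1} \frac{sc}j z^{-j} \tau^j) = (1 + z^{-1}\tau)^{sc}$, where $\tau$ shifts
  the mode by one. The proof is the comparison of coefficients after one differentiation.\<close>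

lemma Delta_charged:
  assumes x: "charge c x" "c \<noteq> 0"
  shows "Delta s i (X x m u)
    = (\<Sum>t\<le>i. scale (of_int (int s * c) gchoose t) (X x (m + int t) (Delta s (i - t) u)))"
proof (induction i rule: less_induct)
  case (less i)
  define z :: complex where "z = of_int (int s * c)"
  show ?case
  proof (cases i)
    case (Suc n)
    have comm: "J l (X x m' v) = X x m' (J l v) + scale (of_int c) (X x (l + m') v)" for l m' v
      using J_commute[OF x(1), of l m' v] sl_form_charge[OF central_elt_charge x(1)] x(2) by simp
    define G where "G j t = scale (z gchoose t) (X x (m + int t) (scale (of_nat s * (-1) ^ j) (J (int (Suc j)) (Delta s (n - j - t) u))))" for j t
    define H where "H j t = scale ((-1) ^ j * (z gchoose t) * z) (X x (m + int (j + t + 1)) (Delta s (n - j - t) u))" for j t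
    have "scale (of_nat i) (Delta s i (X x m u))
      = scale (of_nat s) (\<Sum>j\<le>n. scale ((-1) ^ j) (J (int (Suc j)) (\<Sum>t\<le>n - j. scale (z gchoose t) (X x (m + int t) (Delta s (n - j - t) u)))))"
      unfolding Suc Delta_Suc z_def using less.IH by (simp add: Suc)
    also have "\<dots> = (\<Sum>j\<le>n. \<Sum>t\<le>n - j. G j t)
      + (\<Sum>j\<le>n. \<Sum>t\<le>n - j. H j t)"
    proof -
      have *: "scale (of_nat s) (scale ((-1) ^ j) (J (int (Suc j)) (scale (z gchoose t) (X x (m + int t) v))))
        = scale (z gchoose t) (X x (m + int t) (scale (of_nat s * (-1) ^ j) (J (int (Suc j)) v)))
          + scale ((-1) ^ j * (z gchoose t) * z) (X x (m + int (j + t + 1)) v)" for j t v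
      proof -
        have eq: "int (Suc j) + (m + int t) = m + int (j + t + 1)" by simp
        have z: "of_nat s * ((-1) ^ j * ((z gchoose t) * of_int c)) = (-1) ^ j * (z gchoose t) * z"
          by (simp add: z_def mult_ac)
        show ?thesis
          by (simp only: X_scale comm scale_right_distrib scale_scale eq z)
            (simp only: mult_ac)
      qed
      show ?thesis
        by (simp only: X_sum scale_sum_right * sum.distrib G_def H_def)
    qed
    also have "(\<Sum>j\<le>n. \<Sum>t\<le>n - j. G j t)
      = (\<Sum>t\<le>n. scale (z gchoose t) (X x (m + int t) (scale (of_nat s) (\<Sum>j\<le>n - t. scale ((-1) ^ j) (J (int (Suc j)) (Delta s (n - t - j) u))))))"
      by (subst sum_triangle_swap) (simp add: G_def X_sum scale_sum_right add.commute)
    also have "\<dots> = (\<Sum>t\<le>n. scale (of_nat (i - t) * (z gchoose t)) (X x (m + int t) (Delta s (i - t) u)))"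
      unfolding Delta_Suc[symmetric]
      by (intro sum.cong refl) (simp add: X_scale Suc Suc_diff_le mult.commute del: of_nat_Suc)
    also have "(\<Sum>j\<le>n. \<Sum>t\<le>n - j. H j t)
      = (\<Sum>p\<le>n. \<Sum>t\<le>p. scale ((-1) ^ (p - t) * (z gchoose t) * z) (X x (m + int (Suc p)) (Delta s (n - p) u)))"
      by (subst sum_triangle_diagonal) (intro sum.cong refl, simp add: H_def)
    also have "\<dots> = (\<Sum>p\<le>n. scale (of_nat (Suc p) * (z gchoose Suc p)) (X x (m + int (Suc p)) (Delta s (n - p) u)))"
      by (simp only: gbinomial_alternating_sum[symmetric] sum_distrib_right scale_sum_left)
    also have "\<dots> = (\<Sum>t\<in>{1..i}. scale (of_nat t * (z gchoose t)) (X x (m + int t) (Delta s (i - t) u)))"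
      by (rule sum.reindex_bij_witness[of _ "\<lambda>t. t - 1" Suc]) (auto simp: Suc)
    also have "\<dots> = (\<Sum>t\<le>i. scale (of_nat t * (z gchoose t)) (X x (m + int t) (Delta s (i - t) u)))"
      by (rule sum.mono_neutral_left) auto
    also have "(\<Sum>t\<le>n. scale (of_nat (i - t) * (z gchoose t)) (X x (m + int t) (Delta s (i - t) u)))
      = (\<Sum>t\<le>i. scale (of_nat (i - t) * (z gchoose t)) (X x (m + int t) (Delta s (i - t) u)))"
      by (simp add: Suc)
    also have "\<dots> + (\<Sum>t\<le>i. scale (of_nat t * (z gchoose t)) (X x (m + int t) (Delta s (i - t) u)))
      = scale (of_nat i) (\<Sum>t\<le>i. scale (z gchoose t) (X x (m + int t) (Delta s (i - t) u)))"
      unfolding scale_sum_right sum.distrib[symmetric]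
      by (intro sum.cong refl) (simp add: of_nat_diff left_diff_distrib flip: scale_left_distrib)
    finally show ?thesis using Suc by (simp add: z_def del: of_nat_Suc)
  qed simp
qed

text \<open>For charge $0$ modes are not shifted, and the central term of $[J(j), x(-1-q)]$ contributes, only for
  $j = q + 1$.\<close>

lemma Delta_neutral:
  assumes x: "charge 0 x"
  shows "Delta s i (X x (-1 - int q) u) = X x (-1 - int q) (Delta s i u)
    + (if i \<ge> Suc q then scale (of_nat s * (-1) ^ q * (sl_form central_elt x * of_nat k)) (Delta s (i - Suc q) u) else 0)"
proof (induction i rule: less_induct)
  case (less i)
  define \<mu> where "\<mu> = sl_form central_elt x * of_nat k"
  define \<beta> where "\<beta> = of_nat s * (-1) ^ q * \<mu>"
  show ?case
  proof (cases i)
    case (Suc n)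
    have comm: "J (int (Suc j)) (X x (-1 - int q) v) = X x (-1 - int q) (J (int (Suc j)) v)
        + (if j = q then scale (of_nat (Suc q) * \<mu>) v else 0)" for j v
      using J_commute[OF x, of "int (Suc j)" "-1 - int q" v] by (auto simp: \<mu>_def mult.assoc)
    have "scale (of_nat i) (Delta s i (X x (-1 - int q) u))
      = scale (of_nat s) (\<Sum>j\<le>n. scale ((-1) ^ j) (J (int (Suc j)) (X x (-1 - int q) (Delta s (n - j) u)
          + (if n - j \<ge> Suc q then scale \<beta> (Delta s (n - j - Suc q) u) else 0))))"
      unfolding Suc Delta_Suc \<beta>_def \<mu>_def using less.IH by (simp add: Suc)
    also have "\<dots> = X x (-1 - int q) (scale (of_nat s) (\<Sum>j\<le>n. scale ((-1) ^ j) (J (int (Suc j)) (Delta s (n - j) u))))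
      + (\<Sum>j\<le>n. if j = q then scale (of_nat (Suc q) * \<beta>) (Delta s (n - j) u) else 0)
      + scale (of_nat s) (\<Sum>j\<le>n. if n - j \<ge> Suc q then scale ((-1) ^ j * \<beta>) (J (int (Suc j)) (Delta s (n - j - Suc q) u)) else 0)"
    proof -
      have *: "scale (of_nat s) (scale ((-1) ^ j) (J (int (Suc j)) (X x (-1 - int q) (Delta s (n - j) u)
          + (if n - j \<ge> Suc q then scale \<beta> (Delta s (n - j - Suc q) u) else 0))))
        = X x (-1 - int q) (scale (of_nat s) (scale ((-1) ^ j) (J (int (Suc j)) (Delta s (n - j) u))))
        + (if j = q then scale (of_nat (Suc q) * \<beta>) (Delta s (n - j) u) else 0)
        + scale (of_nat s) (if n - j \<ge> Suc q then scale ((-1) ^ j * \<beta>) (J (int (Suc j)) (Delta s (n - j - Suc q) u)) else 0)" for j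
        by (simp only: X_add X_scale comm scale_right_distrib)
          (simp add: X_scale X_zero \<beta>_def mult_ac del: of_nat_Suc)
      show ?thesis
        unfolding scale_sum_right X_sum * sum.distrib ..
    qed
    also have "scale (of_nat s) (\<Sum>j\<le>n. scale ((-1) ^ j) (J (int (Suc j)) (Delta s (n - j) u))) = scale (of_nat i) (Delta s i u)"
      unfolding Suc Delta_Suc ..
    also have "(\<Sum>j\<le>n. if j = q then scale (of_nat (Suc q) * \<beta>) (Delta s (n - j) u) else 0)
      = (if i \<ge> Suc q then scale (of_nat (Suc q) * \<beta>) (Delta s (i - Suc q) u) else 0)"
      by (simp add: Suc del: of_nat_Suc)
    also have "scale (of_nat s) (\<Sum>j\<le>n. if n - j \<ge> Suc q then scale ((-1) ^ j * \<beta>) (J (int (Suc j)) (Delta s (n - j - Suc q) u)) else 0)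
      = (if i \<ge> Suc q then scale (of_nat (i - Suc q) * \<beta>) (Delta s (i - Suc q) u) else 0)"
    proof (cases "n \<ge> Suc q")
      case True
      then obtain r where r: "n = Suc q + r" using le_iff_add by blast
      have "(\<Sum>j\<le>n. if n - j \<ge> Suc q then scale ((-1) ^ j * \<beta>) (J (int (Suc j)) (Delta s (n - j - Suc q) u)) else 0)
        = (\<Sum>j\<le>r. scale ((-1) ^ j * \<beta>) (J (int (Suc j)) (Delta s (r - j) u)))"
        by (rule sum.mono_neutral_cong_right) (auto simp: r)
      also have "scale (of_nat s) \<dots> = scale \<beta> (scale (of_nat s) (\<Sum>j\<le>r. scale ((-1) ^ j) (J (int (Suc j)) (Delta s (r - j) u))))"
        by (simp add: scale_sum_right mult_ac)
      finally show ?thesis unfolding Delta_Suc[symmetric] by (simp add: r Suc mult.commute del: of_nat_Suc)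
    next
      case False
      then have "n - j < Suc q" for j by linarith
      with False show ?thesis by (auto simp: Suc not_le[symmetric])
    qed
    finally have "scale (of_nat i) (Delta s i (X x (-1 - int q) u)) = scale (of_nat i)
       (X x (-1 - int q) (Delta s i u) + (if i \<ge> Suc q then scale \<beta> (Delta s (i - Suc q) u) else 0))"
      by (cases "i \<ge> Suc q") (auto simp: X_scale scale_right_distrib add.assoc of_nat_diff simp del: of_nat_Suc simp flip: scale_left_distrib distrib_right)
    then show ?thesis using Suc by (simp add: \<beta>_def \<mu>_def del: of_nat_Suc)
  qed simp
qed

text \<open>Both cases at once: for $c = 0$ the binomial coefficients vanish except the first, for $c \ne 0$ the
  form $(J|x)$ vanishes.\<close>

lemma Delta_X:
  assumes x: "charge c x"
  shows "Delta s i (X x (-1 - int q) u)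
    = (\<Sum>t\<le>i. scale (of_int (int s * c) gchoose t) (X x (-1 - int q + int t) (Delta s (i - t) u)))
    + (if i \<ge> Suc q then scale (of_nat s * (-1) ^ q * (sl_form central_elt x * of_nat k)) (Delta s (i - Suc q) u) else 0)"
proof (cases "c = 0")
  case True
  have "(\<Sum>t\<le>i. scale (of_int (int s * c) gchoose t) (X x (-1 - int q + int t) (Delta s (i - t) u)))
    = (\<Sum>t\<in>{0}. scale (of_int (int s * c) gchoose t) (X x (-1 - int q + int t) (Delta s (i - t) u)))"
    by (rule sum.mono_neutral_right) (auto simp: True gr0_conv_Suc)
  then show ?thesis using Delta_neutral[of x s i q u] x True by simp
next
  case False
  then show ?thesis using Delta_charged[OF x False, of s i "-1 - int q" u] sl_form_charge[OF central_elt_charge x] by simp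
qed

section \<open>Fields of the spectral flow\<close>

text \<open>The coefficient of $z^{-l-1}$ in $Y(\Delta(z)u, z)y$. The factor $z^{sJ(0)}$ of the spectral flow
  is left out; it shifts $l$ by $s$ times the charge of $u$.\<close>

definition twisted_mode :: "nat \<Rightarrow> 'v \<Rightarrow> int \<Rightarrow> 'v \<Rightarrow> 'v" where
  "twisted_mode s u l y = Sum_any (\<lambda>i::nat. Y (Delta s i u) (l - int i) y)"

lemma twisted_mode_eq_sum: "(\<And>i. i > M \<Longrightarrow> Delta s i u = 0) \<Longrightarrow> twisted_mode s u l y = (\<Sum>i\<le>M. Y (Delta s i u) (l - int i) y)"
  unfolding twisted_mode_def by (rule Sum_any_eq_atMost) (simp add: Y_zero_left)

lemma twisted_mode_add: "twisted_mode s (u + v) l y = twisted_mode s u l y + twisted_mode s v l y"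
proof -
  obtain M N where M: "\<And>i. i > M \<Longrightarrow> Delta s i u = 0" and N: "\<And>i. i > N \<Longrightarrow> Delta s i v = 0"
    using Delta_finite by metis
  have "twisted_mode s u l y = (\<Sum>i\<le>max M N. Y (Delta s i u) (l - int i) y)"
    "twisted_mode s v l y = (\<Sum>i\<le>max M N. Y (Delta s i v) (l - int i) y)"
    "twisted_mode s (u + v) l y = (\<Sum>i\<le>max M N. Y (Delta s i (u + v)) (l - int i) y)"
    by (rule twisted_mode_eq_sum; simp add: M N Delta_add)+
  then show ?thesis by (simp add: Delta_add Y_add_left sum.distrib)
qed

lemma twisted_mode_scale: "twisted_mode s (scale \<alpha> u) l y = scale \<alpha> (twisted_mode s u l y)"
proof -
  obtain M where M: "\<And>i. i > M \<Longrightarrow> Delta s i u = 0"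
    using Delta_finite by metis
  have "twisted_mode s u l y = (\<Sum>i\<le>M. Y (Delta s i u) (l - int i) y)"
    "twisted_mode s (scale \<alpha> u) l y = (\<Sum>i\<le>M. Y (Delta s i (scale \<alpha> u)) (l - int i) y)"
    by (rule twisted_mode_eq_sum; simp add: M Delta_scale)+
  then show ?thesis by (simp add: Delta_scale Y_scale_left scale_sum_right)
qed

lemma twisted_mode_scale_right: "twisted_mode s u l (scale \<alpha> y) = scale \<alpha> (twisted_mode s u l y)"
proof -
  obtain M where M: "\<And>i. i > M \<Longrightarrow> Delta s i u = 0"
    using Delta_finite by metis
  show ?thesis by (simp add: twisted_mode_eq_sum[OF M] Y_scale_right scale_sum_right)
qed

lemma twisted_mode_zero_right: "twisted_mode s u l 0 = 0"
  using twisted_mode_scale_right[of s u l 0 0] by simp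

lemma twisted_mode_vac: "twisted_mode s vac l y = (if l = -1 then y else 0)"
proof -
  have "twisted_mode s vac l y = (\<Sum>i\<le>0. Y (Delta s i vac) (l - int i) y)"
    by (rule twisted_mode_eq_sum) (simp add: Delta_vac)
  then show ?thesis by (simp add: vacuum)
qed

text \<open>The Borcherds identity for the fields of the spectral flow, restricted to what is needed. Moving $\Delta(z)$
  past $x(-1-q)$ produces the binomial coefficients of $(1 + z^{-1}\tau)^{sc}$, which are those on the left of the
  Borcherds identity with $m = sc$. On its right only $x(sc)$ survives, since $y$ is killed by the higher modes
  $x(sc + p)$ and the modes of $u$ that occur vanish on $y$. The last summand is the central term of
  $\Delta(z)$, which amounts to the scalar shift of $J(0)$.\<close>

lemma twisted_mode_X:
  assumes x: "charge c x" and u: "word N e u" and y: "top_vector s y"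
    and zero: "\<And>p::nat. twisted_mode s u (L - int s * c + int p) y = 0"
  shows "twisted_mode s (X x (-1 - int q) u) L y
    = scale ((-1) ^ q * super_sign (odd c) (odd e)) (twisted_mode s u (L - int s * c - 1 - int q) (X x (int s * c) y))
      + scale (of_nat s * (-1) ^ q * (sl_form central_elt x * of_nat k)) (twisted_mode s u (L - 1 - int q) y)"
proof -
  define z :: complex where "z = of_int (int s * c)"
  define l where "l = -1 - int q"
  define \<beta> where "\<beta> = of_nat s * (-1) ^ q * (sl_form central_elt x * of_nat k)"
  define g where "g = (super_sign (odd c) (odd e) :: complex)"
  obtain M where M: "\<And>i. i > M \<Longrightarrow> Delta s i u = 0"
    using Delta_finite by metis
  note ZM = twisted_mode_eq_sum[OF M]
  have "\<exists>R. \<forall>i\<le>M. \<forall>t>R. X x (l + int t) (Delta s i u) = 0"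
  proof -
    have "\<exists>R. \<forall>t>R. X x (l + int t) (Delta s i u) = 0" for i
    proof -
      obtain R where R: "\<And>m. m \<ge> R \<Longrightarrow> X x m (Delta s i u) = 0" using X_truncation by blast
      have "X x (l + int t) (Delta s i u) = 0" if "t > nat (R - l)" for t
        by (rule R) (use that in linarith)
      then show ?thesis by blast
    qed
    then obtain R where R: "\<And>i t. t > R i \<Longrightarrow> X x (l + int t) (Delta s i u) = 0" by metis
    have "R i \<le> Max (R ` {..M})" if "i \<le> M" for i using that by (intro Max_ge) auto
    then show ?thesis by (intro exI[of _ "Max (R ` {..M})"]) (meson R le_less_trans)
  qed
  then obtain R where R: "\<And>i t. t > R \<Longrightarrow> X x (l + int t) (Delta s i u) = 0"
    using M by (metis X_zero not_le)
  have "\<exists>P. \<forall>i\<le>M. \<forall>p>P. Y (Delta s i u) (L - int i - int s * c + int p) y = 0"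
  proof -
    have "\<exists>P. \<forall>p>P. Y (Delta s i u) (L - int i - int s * c + int p) y = 0" for i
    proof -
      obtain P where P: "\<And>m. m \<ge> P \<Longrightarrow> Y (Delta s i u) m y = 0" using truncation by blast
      have "Y (Delta s i u) (L - int i - int s * c + int p) y = 0" if "p > nat (P - (L - int i - int s * c))" for p
        by (rule P) (use that in linarith)
      then show ?thesis by blast
    qed
    then obtain P where P: "\<And>i p. p > P i \<Longrightarrow> Y (Delta s i u) (L - int i - int s * c + int p) y = 0" by metis
    have "P i \<le> Max (P ` {..M})" if "i \<le> M" for i using that by (intro Max_ge) auto
    then show ?thesis by (intro exI[of _ "Max (P ` {..M})"]) (meson P le_less_trans)
  qed
  then obtain P where P: "\<And>i p. p > P \<Longrightarrow> Y (Delta s i u) (L - int i - int s * c + int p) y = 0"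
    using M by (metis Y_zero_left not_le)
  have y0: "X x (int s * c + int p) y = 0" if "p > 0" for p
    using y x that unfolding top_vector_def by (metis add.commute of_nat_0_less_iff)
  \<comment> \<open>All sums below are over a finite range: $M$, $R$, $P$ bound the supports in $i$, $t$, $p$.\<close>
  define K where "K = M + R + Suc q"
  define A where "A i t = scale (z gchoose t) (Y (X x (l + int t) (Delta s i u)) (L - int i - int t) y)" for i t
  have A0: "A i t = 0" if "i > M \<or> t > R" for i t
    using that by (auto simp: A_def M R X_zero Y_zero_left)
  have DX: "Delta s i (X x l u) = (\<Sum>t\<le>i. scale (z gchoose t) (X x (l + int t) (Delta s (i - t) u)))
    + (if i \<ge> Suc q then scale \<beta> (Delta s (i - Suc q) u) else 0)" for i
    unfolding l_def z_def \<beta>_def by (rule Delta_X[OF x])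
  have "twisted_mode s (X x l u) L y = (\<Sum>i\<le>K. Y (Delta s i (X x l u)) (L - int i) y)"
  proof (rule twisted_mode_eq_sum)
    fix i assume i: "i > K"
    have "X x (l + int t) (Delta s (i - t) u) = 0" for t
    proof (cases "t > R")
      case False
      then have "i - t > M" using i by (simp add: K_def)
      then show ?thesis by (simp add: M X_zero)
    qed (rule R)
    moreover have "i - Suc q > M" using i by (simp add: K_def)
    ultimately show "Delta s i (X x l u) = 0" by (simp add: DX M)
  qed
  also have "\<dots> = (\<Sum>i\<le>K. \<Sum>t\<le>i. A (i - t) t)
    + (\<Sum>i\<le>K. if i \<ge> Suc q then scale \<beta> (Y (Delta s (i - Suc q) u) (L - int i) y) else 0)"
  proof -
    have Ysum: "Y (sum f S) m w = (\<Sum>i\<in>S. Y (f i) m w)" for f :: "nat \<Rightarrow> 'v" and S m w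
      by (induction S rule: infinite_finite_induct) (auto simp: Y_zero_left Y_add_left)
    show ?thesis
      unfolding DX Y_add_left Ysum sum.distrib[symmetric]
      by (intro sum.cong refl arg_cong2[where f = "(+)"])
        (auto simp: A_def Y_scale_left Y_zero_left of_nat_diff)
  qed
  also have "(\<Sum>i\<le>K. if i \<ge> Suc q then scale \<beta> (Y (Delta s (i - Suc q) u) (L - int i) y) else 0)
    = scale \<beta> (twisted_mode s u (L - 1 - int q) y)"
  proof -
    have "(\<Sum>i\<le>K. if i \<ge> Suc q then scale \<beta> (Y (Delta s (i - Suc q) u) (L - int i) y) else 0)
      = (\<Sum>i\<in>{Suc q..M + Suc q}. scale \<beta> (Y (Delta s (i - Suc q) u) (L - int i) y))"
      by (rule sum.mono_neutral_cong_right) (auto simp: K_def M Y_zero_left)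
    also have "\<dots> = (\<Sum>i\<le>M. scale \<beta> (Y (Delta s i u) (L - 1 - int q - int i) y))"
      by (rule sum.reindex_bij_witness[of _ "\<lambda>i. i + Suc q" "\<lambda>i. i - Suc q"])
        (auto simp: of_nat_diff algebra_simps)
    finally show ?thesis by (simp add: ZM scale_sum_right)
  qed
  also have "(\<Sum>i\<le>K. \<Sum>t\<le>i. A (i - t) t) = (\<Sum>i\<le>K. \<Sum>t\<le>K - i. A i t)"
    by (rule sum_triangle_diagonal[symmetric])
  also have "\<dots> = (\<Sum>i\<le>M. \<Sum>t\<le>K - i. A i t)"
    by (rule sum.mono_neutral_right) (auto simp: K_def A0)
  also have "\<dots> = (\<Sum>i\<le>M. Sum_any (A i))"
  proof (rule sum.cong[OF refl])
    fix i assume "i \<in> {..M}"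
    then show "(\<Sum>t\<le>K - i. A i t) = Sum_any (A i)"
      by (intro Sum_any_eq_atMost[symmetric] A0) (auto simp: K_def)
  qed
  also have "\<dots> = (\<Sum>i\<le>M. \<Sum>p\<le>P. scale ((-1) ^ p * (of_int l gchoose p))
      (X x (int s * c + l - int p) (Y (Delta s i u) (L - int i - int s * c + int p) y)
         - scale ((-1) powi l * g) (Y (Delta s i u) (L - int i - int s * c + l - int p) (X x (int s * c + int p) y))))"
  proof (rule sum.cong[OF refl])
    fix i
    have "Sum_any (A i) = Sum_any (\<lambda>t::nat. scale (of_int (int s * c) gchoose t) (Y (X x (l + int t) (Delta s i u))
        (int s * c + (L - int i - int s * c) - int t) y))"
      unfolding A_def z_def by simp
    also have "\<dots> = Sum_any (\<lambda>p::nat. scale ((-1) ^ p * (of_int l gchoose p))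
      (X x (int s * c + l - int p) (Y (Delta s i u) (L - int i - int s * c + int p) y)
         - scale ((-1) powi l * g) (Y (Delta s i u) (L - int i - int s * c + l - int p) (X x (int s * c + int p) y))))"
      unfolding g_def
      by (rule jacobi[OF X_parity[OF x] Delta_parity[OF word_parity[OF u]], unfolded X_Y])
    also have "\<dots> = (\<Sum>p\<le>P. scale ((-1) ^ p * (of_int l gchoose p))
      (X x (int s * c + l - int p) (Y (Delta s i u) (L - int i - int s * c + int p) y)
         - scale ((-1) powi l * g) (Y (Delta s i u) (L - int i - int s * c + l - int p) (X x (int s * c + int p) y))))"
      by (rule Sum_any_eq_atMost) (simp add: P y0 X_zero Y_zero_right)
    finally show "Sum_any (A i) = \<dots>" .
  qed
  also have "\<dots> = (\<Sum>p\<le>P. scale ((-1) ^ p * (of_int l gchoose p))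
      (X x (int s * c + l - int p) (twisted_mode s u (L - int s * c + int p) y)
         - scale ((-1) powi l * g) (twisted_mode s u (L - int s * c + l - int p) (X x (int s * c + int p) y))))"
    by (subst sum.swap)
      (simp add: ZM X_sum scale_sum_right sum_subtractf[symmetric] algebra_simps)
  also have "\<dots> = (\<Sum>p\<in>{0}. scale ((-1) ^ p * (of_int l gchoose p))
      (X x (int s * c + l - int p) (twisted_mode s u (L - int s * c + int p) y)
         - scale ((-1) powi l * g) (twisted_mode s u (L - int s * c + l - int p) (X x (int s * c + int p) y))))"
    by (rule sum.mono_neutral_right) (auto simp: y0 zero X_zero twisted_mode_zero_right)
  also have "\<dots> = - scale ((-1) powi l * g) (twisted_mode s u (L - int s * c + l) (X x (int s * c) y))"
    using zero[of 0] by (simp add: X_zero)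
  also have "\<dots> = scale ((-1) ^ q * g) (twisted_mode s u (L - int s * c - 1 - int q) (X x (int s * c) y))"
  proof -
    have "(-1 :: complex) powi l = - ((-1) ^ q)"
    proof -
      have "l = - int (Suc q)" by (simp add: l_def)
      then have "(-1 :: complex) powi l = inverse ((-1) ^ Suc q)"
        by (simp only: power_int_minus power_int_of_nat)
      then show ?thesis by (simp add: power_inverse[symmetric])
    qed
    moreover have "L - int s * c + l = L - int s * c - 1 - int q" by (simp add: l_def)
    ultimately show ?thesis by (simp only: mult_minus_left scale_minus_left minus_minus)
  qed
  finally show ?thesis by (simp only: l_def g_def \<beta>_def)
qed

text \<open>Zero modes preserve lowest weight vectors. No central term arises, as it requires opposite charges and then the
  shifts cancel.\<close>

lemma top_vector_X:
  assumes x: "charge c x" and y: "top_vector s y"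
  shows "top_vector s (X x (int s * c) y)"
  unfolding top_vector_def
proof (intro allI impI)
  fix e z j assume z: "charge e (z :: 'n sl1)" "j > (0::int)"
  have "X z (j + int s * e) y = 0" using y z unfolding top_vector_def by blast
  moreover have "X (sl_bracket z x) (j + int s * e + int s * c) y = 0"
    using y charge_bracket[OF z(1) x] z(2) unfolding top_vector_def
    by (metis add.assoc distrib_left)
  moreover have "sl_form z x = 0" if "j + int s * e + int s * c = 0"
  proof (rule sl_form_charge[OF z(1) x])
    show "e + c \<noteq> 0"
    proof
      assume "e + c = 0"
      then have "int s * e + int s * c = 0" by (metis distrib_left mult_zero_right)
      then show False using that z(2) by simp
    qed
  qed
  ultimately show "X z (j + int s * e) (X x (int s * c) y) = 0"
    by (simp add: X_commute[OF z(1) x] X_zero)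
qed

text \<open>In the spectral flow a word of weight $N$ and charge $e$ has weight $N + se$, so these are the modes
  that lower the weight. The recursion for words reduces the claim to shorter words and to other top vectors,
  which is why $y$ varies in the induction.\<close>

lemma top_vector_annihilated:
  "word N e u \<Longrightarrow> top_vector s y \<Longrightarrow> L \<ge> int N + int s * e \<Longrightarrow> twisted_mode s u L y = 0"
proof (induction arbitrary: y L rule: word.induct)
  case word_vac
  then show ?case by (simp add: twisted_mode_vac)
next
  case (word_step c x N e u q)
  have "int (N + Suc q) + int s * (c + e) \<le> L" by fact
  then have L: "int N + 1 + int q + int s * c + int s * e \<le> L" by (simp add: distrib_left)
  have 1: "twisted_mode s u (L - int s * c + int p) y = 0" for p
    using L by (intro word_step.IH word_step.prems) linarith
  have 2: "twisted_mode s u (L - int s * c - 1 - int q) (X x (int s * c) y) = 0"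
    using L by (intro word_step.IH top_vector_X word_step.hyps word_step.prems) linarith
  have 3: "sl_form central_elt x = 0 \<or> twisted_mode s u (L - 1 - int q) y = 0"
  proof (cases "c = 0")
    case True
    then show ?thesis using L by (intro disjI2 word_step.IH word_step.prems) simp
  next
    case False
    then show ?thesis using sl_form_charge[OF central_elt_charge word_step.hyps(1)] by simp
  qed
  show ?case
    unfolding twisted_mode_X[OF word_step.hyps(1,2) word_step.prems(1) 1]
    using 2 3 by auto
qed

text \<open>The index of the zero mode depends on the weight $N + se$, an eigenvalue of $L(0) + sJ(0)$; the weight
  spaces of this operator serve to define the zero mode linearly on all of $V$.\<close>

lemma zero_mode:
  assumes w: "top_vector s w"
  obtains F where "\<And>v w. F (v + w) = F v + F w" "\<And>c v. F (scale c v) = scale c (F v)"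
    "\<And>N e u. word N e u \<Longrightarrow> F u = twisted_mode s u (int N + int s * e - 1) w"
proof -
  define D where "D v = L0 v + scale (of_nat s) (J 0 v)" for v
  have D: "D (v + w) = D v + D w" "D (scale c v) = scale c (D v)" for v w c
    by (simp_all add: D_def L0_add L0_scale X_add X_scale scale_right_distrib scale_left_commute)
  have eig: "D u = scale (of_int (int N + int s * e)) u" if "word N e u" for N e u
    using word_L0[OF that] word_J[OF that] by (simp add: D_def scale_left_distrib)
  have "span {v. \<exists>N e. word N e v} \<subseteq> span {v. \<exists>\<mu>. D v = scale \<mu> v}"
    by (rule span_mono) (use eig in blast)
  then have D_span: "span {v. \<exists>\<mu>. D v = scale \<mu> v} = UNIV" using span_words by auto
  obtain F where F: "\<And>v w. F (v + w) = F v + F w" "\<And>c v. F (scale c v) = scale c (F v)"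
    "\<And>\<mu> v. D v = scale \<mu> v \<Longrightarrow> F v = twisted_mode s v (\<lfloor>Re \<mu>\<rfloor> - 1) w"
    by (rule eigenspace_linear_extension[of D "\<lambda>\<mu> v. twisted_mode s v (\<lfloor>Re \<mu>\<rfloor> - 1) w", OF D D_span twisted_mode_add twisted_mode_scale]) blast
  show thesis
  proof (rule that[OF F(1,2)])
    show "F u = twisted_mode s u (int N + int s * e - 1) w" if "word N e u" for N e u
      using F(3)[OF eig[OF that]] by (simp only: complex_Re_of_int floor_of_int)
  qed
qed

text \<open>The zero mode of $x(-1-q)u$ on a lowest weight vector depends on $q$ only through the sign $(-1)^q$.\<close>

lemma zero_mode_zhu_relations:
  assumes w: "top_vector s w"
    and F: "\<And>v w. F (v + w) = F v + F w" "\<And>c v. F (scale c v) = scale c (F v)"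
      "\<And>N e u. word N e u \<Longrightarrow> F u = twisted_mode s u (int N + int s * e - 1) w"
    and v: "v \<in> span zhu_relations"
  shows "F v = 0"
proof -
  have "F v \<in> {0}"
  proof (rule span_image_subspace[OF F(1,2) _ subspace_single_0 v])
    fix y assume "y \<in> zhu_relations"
    then obtain c x q N e u where x: "charge c x" "word N e u"
      and y: "y = X x (-1 - int (Suc q)) u + X x (-1 - int q) u" by (auto simp: zhu_relations_def)
    have 1: "F (X x (-1 - int p) u)
      = scale ((-1) ^ p * super_sign (odd c) (odd e)) (twisted_mode s u (int N + int s * e - 1) (X x (int s * c) w))
      + scale (of_nat s * (-1) ^ p * (sl_form central_elt x * of_nat k)) (twisted_mode s u (int N + int s * (c + e) - 1) w)" for p
    proof -
      let ?L = "int (N + Suc p) + int s * (c + e) - 1"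
      have 0: "twisted_mode s u (?L - int s * c + int i) w = 0" for i
        by (rule top_vector_annihilated[OF x(2) w]) (simp add: distrib_left)
      have e: "?L - int s * c - 1 - int p = int N + int s * e - 1" "?L - 1 - int p = int N + int s * (c + e) - 1"
        by (simp_all add: distrib_left)
      show ?thesis
        unfolding F(3)[OF word_step[OF x]] twisted_mode_X[OF x w 0] e ..
    qed
    show "F y \<in> {0}"
      unfolding y F(1) 1 by simp
  qed
  then show ?thesis by simp
qed

lemma zero_mode_heisenberg:
  assumes w: "top_vector s w" "J 0 w = scale (of_int r) w"
    and F: "\<And>N e u. word N e u \<Longrightarrow> F u = twisted_mode s u (int N + int s * e - 1) w"
  shows "F ((J (-1) ^^ i) vac)
    = scale ((of_int r + of_nat s * (sl_form central_elt (central_elt :: 'n sl1) * of_nat k)) ^ i) w"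
proof (induction i)
  case 0
  then show ?case using F[OF word_vac] by (simp add: twisted_mode_vac)
next
  case (Suc i)
  let ?u = "(J (-1) ^^ i) vac"
  have 0: "twisted_mode s ?u (int i - int s * 0 + int p) w = 0" for p
    by (rule top_vector_annihilated[OF heisenberg_word w(1)]) simp
  have "F ((J (-1) ^^ Suc i) vac) = twisted_mode s (X central_elt (-1 - int 0) ?u) (int i) w"
    using F[OF heisenberg_word[of "Suc i"]] by simp
  also have "\<dots> = scale (of_int r) (twisted_mode s ?u (int i - 1) w)
      + scale (of_nat s * (sl_form central_elt (central_elt :: 'n sl1) * of_nat k)) (twisted_mode s ?u (int i - 1) w)"
    unfolding twisted_mode_X[OF central_elt_charge heisenberg_word w(1) 0]
    by (simp add: super_sign_def w(2) twisted_mode_scale_right)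
  also have "twisted_mode s ?u (int i - 1) w = F ?u" using F[OF heisenberg_word[of i]] by simp
  finally show ?case unfolding Suc by (simp add: distrib_right scale_left_distrib)
qed

section \<open>Failure of $C_2$-cofiniteness\<close>

theorem not_C2_cofinite: "\<not> C2_cofinite"
proof
  assume C2_cofinite
  then obtain c n where c: "(\<Sum>i\<le>n. scale (c i) ((J (-1) ^^ i) vac)) \<in> span zhu_relations" "\<exists>i\<le>n. c i \<noteq> 0"
    by (rule cofinite_relation)
  \<comment> \<open>Minus the increment of $J(0)$ under the spectral flow by one unit.\<close>
  define \<kappa> :: real where "\<kappa> = of_nat k * (of_nat CARD('n) / of_nat (CARD('n) - 1))"
  have \<kappa>: "sl_form central_elt (central_elt :: 'n sl1) * of_nat k = - of_real \<kappa>"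
    using card by (simp add: central_elt_norm \<kappa>_def)
  have "\<kappa> \<ge> 1"
  proof -
    have "1 \<le> real CARD('n) / real (CARD('n) - 1)" using card by (simp add: le_divide_eq)
    moreover have "1 \<le> real k" using level_pos by simp
    ultimately show ?thesis unfolding \<kappa>_def by (metis mult_mono mult_1 zero_le_one of_nat_0_le_iff order_trans)
  qed
  obtain N0 where N0: "\<And>N r v. bihom N r v \<Longrightarrow> v \<noteq> 0 \<Longrightarrow> N \<ge> N0"
    using weights_bounded by blast
  have root: "\<exists>\<mu>. (\<Sum>i\<le>n. c i * \<mu> ^ i) = 0 \<and> Re \<mu> \<le> \<bar>of_int N0\<bar> - real s" if "s > 0" for s
  proof -
    obtain w N r where w: "w \<noteq> 0" "bihom N r w" "N + int s * r \<le> 0" "top_vector s w"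
      by (rule top_vector_exists)
    obtain F where F: "\<And>v w. F (v + w) = F v + F w" "\<And>c v. F (scale c v) = scale c (F v)"
      "\<And>N e u. word N e u \<Longrightarrow> F u = twisted_mode s u (int N + int s * e - 1) w"
      by (rule zero_mode[OF w(4)]) blast
    define \<mu> :: complex where "\<mu> = of_int r + of_nat s * (- of_real \<kappa>)"
    have F0: "F 0 = 0" using F(2)[of 0 0] by simp
    have Fsum: "F (sum g A) = (\<Sum>i\<in>A. F (g i))" for g :: "nat \<Rightarrow> 'v" and A
      by (induction A rule: infinite_finite_induct) (auto simp: F0 F(1))
    have J0: "J 0 w = scale (of_int r) w" using w(2) by (simp add: bihom_def)
    have heis: "F ((J (-1) ^^ i) vac) = scale (\<mu> ^ i) w" for i
      using zero_mode_heisenberg[OF w(4) J0, of F i] F(3) unfolding \<kappa> \<mu>_def by blast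
    have "F (\<Sum>i\<le>n. scale (c i) ((J (-1) ^^ i) vac)) = scale (\<Sum>i\<le>n. c i * \<mu> ^ i) w"
      unfolding Fsum F(2) heis by (simp add: scale_sum_left)
    then have "(\<Sum>i\<le>n. c i * \<mu> ^ i) = 0"
      using zero_mode_zhu_relations[OF w(4) F c(1)] w(1) by simp
    \<comment> \<open>A bound independent of $s$, in the same direction as the shift of $J(0)$.\<close>
    moreover have "r \<le> \<bar>N0\<bar>"
    proof (rule ccontr)
      assume "\<not> r \<le> \<bar>N0\<bar>"
      then have "r > \<bar>N0\<bar>" "r \<ge> 0" by linarith+
      then have "int s * r \<ge> r" using that by (simp add: mult_le_cancel_right1)
      then show False using N0[OF w(2,1)] w(3) \<open>r > \<bar>N0\<bar>\<close> by linarith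
    qed
    then have "real_of_int r \<le> \<bar>of_int N0\<bar>" by linarith
    then have "Re \<mu> \<le> \<bar>of_int N0\<bar> - real s"
      using mult_left_mono[OF \<open>\<kappa> \<ge> 1\<close>, of "real s"] by (simp add: \<mu>_def)
    ultimately show ?thesis by blast
  qed
  let ?R = "{\<mu>. (\<Sum>i\<le>n. c i * \<mu> ^ i) = 0}"
  have fin: "finite ?R" using c(2) by (subst polyfun_finite_roots) blast
  define b where "b = Min (Re ` ?R)"
  have b: "b \<le> Re \<mu>" if "\<mu> \<in> ?R" for \<mu> unfolding b_def using fin that by (intro Min_le) auto
  \<comment> \<open>The roots found for large $s$ lie to the left of all roots.\<close>
  obtain s :: nat where "real s > \<bar>of_int N0\<bar> - b" using reals_Archimedean2 by blast
  then have "real (Suc s) > \<bar>of_int N0\<bar> - b" by simp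
  then show False using root[of "Suc s"] b by fastforce
qed

end

theorem theorem4p4:
  fixes k d :: nat and h :: complex
    and scale :: "complex \<Rightarrow> 'v::ab_group_add \<Rightarrow> 'v"
    and V :: "bool \<Rightarrow> 'v set" and Y :: "'v \<Rightarrow> int \<Rightarrow> 'v \<Rightarrow> 'v" and vac \<omega> :: 'v
    and act :: "'n::finite affine \<Rightarrow> 'v \<Rightarrow> 'v"
    and proj :: "'n free_alg set \<Rightarrow> 'v"
    and a b :: "nat \<Rightarrow> 'n sl1"
  assumes n: "CARD('n) \<ge> 2"
    and k: "k > 0"
    and L: "irreducible_vk_quotient scale (of_nat k) act proj"
    and VOSA: "vertex_operator_superalgebra scale V Y vac \<omega>"
    and vac: "vac = proj (vk_class (of_nat k) 1)"
    and parity_even: "\<And>x. sl_even x \<Longrightarrow> act (mode x (-1)) vac \<in> V False"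
    and parity_odd: "\<And>x. sl_odd x \<Longrightarrow> act (mode x (-1)) vac \<in> V True"
    and fields: "\<And>x m v. Y (act (mode x (-1)) vac) m v = act (mode x m) v"
    and bases: "dual_bases d a b"
    and coxeter: "is_dual_coxeter_number TYPE('n) h"
    and omega: "\<omega> = scale (1 / (2 * (of_nat k + h)))
                  (\<Sum>i<d. act (mode (a i) (-1)) (act (mode (b i) (-1)) vac))"
  shows "\<not> vertex_superalgebra.C2_cofinite scale Y"
proof -
  interpret L: irreducible_vk_quotient scale "of_nat k" act proj by (rule L)
  interpret VOSA: vertex_operator_superalgebra scale V Y vac \<omega> by (rule VOSA)
  have vac': "vac = L.cls 1" by (simp add: vac L.cls_def)
  interpret sl_vosa scale V Y vac \<omega> k d h "\<lambda>x m. act (mode x m)" a b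
  proof
    show "act (mode x (-1)) vac \<in> V (odd c)" if "charge c x" for c x
      using parity_even[OF charge_even[OF that]] parity_odd[OF charge_odd[OF that]] by (cases "odd c") auto
    show "W = UNIV" if "L.subspace W" "vac \<in> W" "\<And>c x m v. charge c x \<Longrightarrow> v \<in> W \<Longrightarrow> act (mode x m) v \<in> W" for W
      using L.generated_by_vacuum that unfolding vac' by blast
    show "act (mode (x + y) m) v = act (mode x m) v + act (mode y m) v" for x y m v
      by (simp only: mode_add L.act_add_left)
    show "act (mode (sl_scale \<alpha> x) m) v = scale \<alpha> (act (mode x m) v)" for \<alpha> x m v
      by (simp only: L.act_scale_left flip: aff_scale_mode)
    show "vac \<noteq> 0" unfolding vac' by (rule L.cls_one_nonzero)
  qed (fact n k fields bases coxeter omega L.act_mode_commute)+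
  show ?thesis by (rule not_C2_cofinite)
qed

end
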